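(* The proper communication graph of the left Krieger cover is a flow invariant for sofic shifts: if $\mathsf{X}$ and $\mathsf{Y}$ are flow equivalent sofic shifts with left Krieger covers $(E_K(\mathsf{X}),\mathcal{L}_K)$ and $(E_K(\mathsf{Y}),\mathcal{L}_K)$, then the proper communication graphs $PC(E_K(\mathsf{X}))$ and $PC(E_K(\mathsf{Y}))$ are isomorphic as directed graphs.
   Context: A shift space $\mathsf{X}$ over a finite alphabet $\mathcal{A}$ is a closed shift-invariant subset of $\mathcal{A}^{\mathbf{Z}}$. $\mathcal{B}(\mathsf{X})$ is its language (set of finite words, including the empty word, occurring in its elements). $\mathsf{X}$ is of finite type (an SFT) if it can be described by a finite set of forbidden words; it is sofic if it is the image of an SFT under a factor map (continuous shift-commuting surjection), equivalently if it is presented by a labelled graph with finitely many vertices and edges. Each $x\in\mathsf{X}$ is written $x=x^-x^+$ with left-ray $x^-=\dots x_{-2}x_{-1}$ and right-ray $x^+=x_0x_1x_2\dots$; $\mathsf{X}^-$, $\mathsf{X}^+$ are the sets of all left-rays, right-rays of elements of $\mathsf{X}$. For $x^+\in\mathsf{X}^+$, $P_\infty(x^+)=\{y^-\in\mathsf{X}^- : y^-x^+\in\mathsf{X}\}$. The left Krieger cover $(E_K(\mathsf{X}),\mathcal{L}_K)$ is the labelled directed graph whose vertices are the sets $P_\infty(x^+)$, $x^+\in\mathsf{X}^+$, with an edge labelled $b$ from $P_\infty(x^+)$ to $P_\infty(y^+)$ if and only if $by^+\in\mathsf{X}^+$ and $P_\infty(x^+)=P_\infty(by^+)$. Let $E$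 be a directed graph. Write $v\ge w$ if there is a path (possibly of length $0$) from $v$ to $w$. Vertices $v,w$ properly communicate if there are paths of length at least one from $v$ to $w$ and from $w$ to $v$. A proper communication set is a maximal nonempty set of vertices any two (not necessarily distinct) of which properly communicate. $PC(E)$ is the directed graph whose vertices are the proper communication sets $PC_i$ of $E$, with exactly one edge from $PC_i$ to $PC_j$, for $i\ne j$, if $v\ge w$ for some $v\in PC_i$, $w\in PC_j$, and no other edges. Flow equivalence is the equivalence relation on shift spaces generated by conjugacy (shift-commuting homeomorphism) and symbol expansion; by a theorem of Parry and Sullivan this is the same as the existence of a homeomorphism between the suspension flow spaces that maps flow orbits to flow orbits preserving their direction. Symbol expansion: for $\mathsf{X}$ over $\mathcal{A}$, $a\in\mathcal{A}$ and a symbol $\ast\notin\mathcal{A}$, let $\mathcal{E}$ insert $\ast$ immediately after every occurrence of $a$; the expanded shift $\mathsf{X}'$ is the shift space over $\mathcal{A}\cup\{\ast\}$ whose language is the set of all subwords of the words $\mathcal{E}(w)$, $w\in\mathcal{B}(\mathsf{X})$. *)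

theory Defs
  imports
    "HOL-Analysis.Analysis"
    "HOL-Library.Sublist"
    "Graph_Theory.Digraph_Isomorphism"
begin

section \<open>Shift spaces\<close>

definition shift_map :: "(int \<Rightarrow> 'a) \<Rightarrow> (int \<Rightarrow> 'a)" where
  "shift_map x = (\<lambda>i. x (i + 1))"

definition full_shift_topology :: "'a set \<Rightarrow> (int \<Rightarrow> 'a) topology" where
  "full_shift_topology A = product_topology (\<lambda>_. discrete_topology A) UNIV"

text \<open>The alphabet \<open>A\<close> is part of the data: it may contain letters that do not occur in \<open>X\<close>.\<close>

definition shift_space :: "'a set \<Rightarrow> (int \<Rightarrow> 'a) set \<Rightarrow> bool" where
  "shift_space A X \<longleftrightarrow>
     finite A \<and> closedin (full_shift_topology A) X \<and> shift_map ` X = X"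

abbreviation shift_topology :: "'a set \<Rightarrow> (int \<Rightarrow> 'a) set \<Rightarrow> (int \<Rightarrow> 'a) topology" where
  "shift_topology A X \<equiv> subtopology (full_shift_topology A) X"

text \<open>Since \<open>[i..j] = []\<close> for \<open>j < i\<close>, the empty word occurs in every point.\<close>

definition occurs_in :: "'a list \<Rightarrow> (int \<Rightarrow> 'a) \<Rightarrow> bool" where
  "occurs_in w x \<longleftrightarrow> (\<exists>i j. w = map x [i..j])"

definition language :: "(int \<Rightarrow> 'a) set \<Rightarrow> 'a list set" where
  "language X = {w. \<exists>x\<in>X. occurs_in w x}"

definition finite_type :: "'a set \<Rightarrow> (int \<Rightarrow> 'a) set \<Rightarrow> bool" where
  "finite_type A X \<longleftrightarrow> finite A \<and>
     (\<exists>F. finite F \<and> F \<subseteq> lists A \<and> X = {x. range x \<subseteq> A \<and> (\<forall>w\<in>F. \<not> occurs_in w x)})"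

definition factor_map ::
    "'a set \<Rightarrow> (int \<Rightarrow> 'a) set \<Rightarrow> 'b set \<Rightarrow> (int \<Rightarrow> 'b) set \<Rightarrow> ((int \<Rightarrow> 'a) \<Rightarrow> (int \<Rightarrow> 'b)) \<Rightarrow> bool" where
  "factor_map A X B Y f \<longleftrightarrow>
     continuous_map (shift_topology A X) (shift_topology B Y) f \<and>
     f ` X = Y \<and> (\<forall>x\<in>X. f (shift_map x) = shift_map (f x))"

text \<open>Up to renaming letters, every finite alphabet is a finite set of natural numbers, so
  quantifying over covering SFTs with such alphabets is no restriction.\<close>

definition sofic :: "'a set \<Rightarrow> (int \<Rightarrow> 'a) set \<Rightarrow> bool" where
  "sofic A X \<longleftrightarrow> shift_space A X \<and>
     (\<exists>(B :: nat set) Y f. finite_type B Y \<and> factor_map B Y A X f)"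

section \<open>Flow equivalence\<close>

definition conjugate ::
    "'a set \<Rightarrow> (int \<Rightarrow> 'a) set \<Rightarrow> 'b set \<Rightarrow> (int \<Rightarrow> 'b) set \<Rightarrow> bool" where
  "conjugate A X B Y \<longleftrightarrow> shift_space A X \<and> shift_space B Y \<and>
     (\<exists>f. homeomorphic_map (shift_topology A X) (shift_topology B Y) f \<and>
          (\<forall>x\<in>X. f (shift_map x) = shift_map (f x)))"

definition expand_word :: "'a \<Rightarrow> 'a \<Rightarrow> 'a list \<Rightarrow> 'a list" where
  "expand_word a s w = concat (map (\<lambda>c. if c = a then [a, s] else [c]) w)"

definition symbol_expansion ::
    "'a set \<Rightarrow> (int \<Rightarrow> 'a) set \<Rightarrow> 'a set \<Rightarrow> (int \<Rightarrow> 'a) set \<Rightarrow> bool" where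
  "symbol_expansion A X B Y \<longleftrightarrow> shift_space A X \<and> shift_space B Y \<and>
     (\<exists>a s. a \<in> A \<and> s \<notin> A \<and> B = insert s A \<and>
        language Y = {u. \<exists>w\<in>language X. sublist u (expand_word a s w)})"

text \<open>The generated equivalence relation passes through shift spaces over varying alphabets. It is
  formed on shift spaces over finite sets of natural numbers, among which every shift space has a
  conjugate copy; conjugation with such copies extends it to shift spaces whose letters come from
  arbitrary, possibly different, types.\<close>

definition flow_equivalent ::
    "'a set \<Rightarrow> (int \<Rightarrow> 'a) set \<Rightarrow> 'b set \<Rightarrow> (int \<Rightarrow> 'b) set \<Rightarrow> bool" where
  "flow_equivalent A X B Y \<longleftrightarrow>
     (\<exists>(A' :: nat set) X' (B' :: nat set) Y'.
        conjugate A X A' X' \<and>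
        equivclp (\<lambda>(C, Z) (C', Z'). conjugate C Z C' Z' \<or> symbol_expansion C Z C' Z')
          (A', X') (B', Y') \<and>
        conjugate B' Y' B Y)"

section \<open>The left Krieger cover\<close>

text \<open>Left-rays are indexed from right to left: \<open>left_ray x n\<close> is $x_{-n-1}$.\<close>

definition left_ray :: "(int \<Rightarrow> 'a) \<Rightarrow> (nat \<Rightarrow> 'a)" where
  "left_ray x = (\<lambda>n. x (- int n - 1))"

definition right_ray :: "(int \<Rightarrow> 'a) \<Rightarrow> (nat \<Rightarrow> 'a)" where
  "right_ray x = (\<lambda>n. x (int n))"

definition glue :: "(nat \<Rightarrow> 'a) \<Rightarrow> (nat \<Rightarrow> 'a) \<Rightarrow> (int \<Rightarrow> 'a)" where
  "glue l r = (\<lambda>i. if i < 0 then l (nat (- i - 1)) else r (nat i))"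

definition predecessor_set :: "(int \<Rightarrow> 'a) set \<Rightarrow> (nat \<Rightarrow> 'a) \<Rightarrow> (nat \<Rightarrow> 'a) set" where
  "predecessor_set X r = {l \<in> left_ray ` X. glue l r \<in> X}"

text \<open>An edge is a triple of source, label and range. \<open>case_nat b r\<close> is the right-ray \<open>r\<close> with the
  letter \<open>b\<close> put in front.\<close>

definition left_krieger_cover ::
    "(int \<Rightarrow> 'a) set \<Rightarrow> ((nat \<Rightarrow> 'a) set, (nat \<Rightarrow> 'a) set \<times> 'a \<times> (nat \<Rightarrow> 'a) set) pre_digraph" where
  "left_krieger_cover X =
     \<lparr> verts = predecessor_set X ` right_ray ` X,
       arcs = {(predecessor_set X q, b, predecessor_set X r) | q b r.
                 q \<in> right_ray ` X \<and> r \<in> right_ray ` X \<and> case_nat b r \<in> right_ray ` X \<and>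
                 predecessor_set X q = predecessor_set X (case_nat b r)},
       tail = (\<lambda>(v, b, w). v),
       head = (\<lambda>(v, b, w). w) \<rparr>"

section \<open>The proper communication graph\<close>

definition properly_communicate :: "('v, 'e) pre_digraph \<Rightarrow> 'v \<Rightarrow> 'v \<Rightarrow> bool" where
  "properly_communicate E v w \<longleftrightarrow> v \<rightarrow>\<^sup>+\<^bsub>E\<^esub> w \<and> w \<rightarrow>\<^sup>+\<^bsub>E\<^esub> v"

definition proper_communication_set :: "('v, 'e) pre_digraph \<Rightarrow> 'v set \<Rightarrow> bool" where
  "proper_communication_set E C \<longleftrightarrow>
     C \<noteq> {} \<and> C \<subseteq> verts E \<and> (\<forall>v\<in>C. \<forall>w\<in>C. properly_communicate E v w) \<and>
     (\<forall>D. C \<subseteq> D \<and> D \<subseteq> verts E \<and> (\<forall>v\<in>D. \<forall>w\<in>D. properly_communicate E v w) \<longrightarrow> D = C)"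

definition proper_communication_graph ::
    "('v, 'e) pre_digraph \<Rightarrow> ('v set, 'v set \<times> 'v set) pre_digraph" where
  "proper_communication_graph E =
     \<lparr> verts = {C. proper_communication_set E C},
       arcs = {(C, D). proper_communication_set E C \<and> proper_communication_set E D \<and> C \<noteq> D \<and>
                       (\<exists>v\<in>C. \<exists>w\<in>D. v \<rightarrow>\<^sup>*\<^bsub>E\<^esub> w)},
       tail = fst,
       head = snd \<rparr>"

end

theory Submission
  imports Defs
begin

text \<open>Following a point \<open>x\<close> to the left, the predecessor sets of its right-rays trace a path backwards
  through the Krieger cover; when the cover is finite, this path ends up in one proper communication
  set, and every proper communication set arises in this way. Whether the set of \<open>x\<close> reaches the set
  of \<open>z\<close> can be read off from the shift space alone: it means that for every \<open>n\<close> some point agrees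
  with \<open>z\<close> on \<open>[n, \<infinity>)\<close> and, up to a shift, far to the left with \<open>x\<close>, its remaining right-ray having
  the same predecessors as that of \<open>x\<close>. This preorder \<open>leads_to\<close> is preserved by conjugacies, because
  they are block codes in both directions, and by symbol expansions. The proper communication graph is
  the quotient of the preorder, and soficity is needed only for the two shifts being compared.\<close>

text \<open>The obstacle is that a conjugacy does not carry vertices to vertices. A block code with
  window \<open>m\<close> reads across every cut, so the image of a right-ray is not even determined
  near the cut. Equality of predecessor sets is carried over only if the two points also agree to
  the left of the cut and the cut is moved left, here by \<open>3 * m\<close>. Hence
  \<open>left_equivalent\<close> asks for both conditions at some cut, and hence the invariant is
  sought at the far left end of a point. The way back to the graph is that paths in the cover lift
  backwards: an edge into the vertex of a point is realised by changing only what lies to the left,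
  because right-rays with equal predecessor sets may be exchanged. Reachability thus becomes the
  existence of a point with prescribed left end and prescribed right part. Running backwards round a
  cycle forever gives, by closedness, a point that belongs to a given proper communication set.
  Finiteness of the cover supplies recurrence: in an infinite cover the path to the left could meet
  each vertex only finitely often.\<close>

definition shift_by :: "int \<Rightarrow> (int \<Rightarrow> 'a) \<Rightarrow> int \<Rightarrow> 'a" where
  "shift_by k x = (\<lambda>i. x (i + k))"

lemma shift_by_apply [simp]: "shift_by k x i = x (i + k)"
  by (simp add: shift_by_def)

lemma shift_by_0 [simp]: "shift_by 0 x = x"
  by (simp add: shift_by_def)

lemma shift_by_shift_by [simp]: "shift_by k (shift_by l x) = shift_by (k + l) x"
  by (simp add: shift_by_def add.assoc)

lemma shift_map_shift_by: "shift_map (shift_by k x) = shift_by (k + 1) x"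
  by (simp add: shift_map_def shift_by_def algebra_simps)

lemma shift_by_mem:
  assumes "shift_map ` X = X" "x \<in> X"
  shows "shift_by k x \<in> X"
proof (induction k rule: int_induct[where k = 0])
  case base
  then show ?case using assms by simp
next
  case (step1 i)
  then have "shift_map (shift_by i x) \<in> X" using assms by blast
  then show ?case by (simp only: shift_map_shift_by)
next
  case (step2 i)
  then obtain z where z: "z \<in> X" "shift_by i x = shift_map z" using assms by blast
  have "x (l + (i - 1)) = z l" for l
    using fun_cong[OF z(2), of "l - 1"] by (simp add: shift_map_def algebra_simps)
  then have "shift_by (i - 1) x = z" by (simp add: shift_by_def)
  then show ?case using z by simp
qed

lemma shift_by_mem_iff:
  assumes "shift_map ` X = X"
  shows "shift_by k x \<in> X \<longleftrightarrow> x \<in> X"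
  using shift_by_mem[OF assms, of "shift_by k x" "-k"] shift_by_mem[OF assms, of x k] by auto

lemma equivariant_shift_by:
  assumes X: "shift_map ` X = X" and f: "\<And>x. x \<in> X \<Longrightarrow> f (shift_map x) = shift_map (f x)"
    and x: "x \<in> X"
  shows "f (shift_by k x) = shift_by k (f x)"
proof (induction k rule: int_induct[where k = 0])
  case base
  then show ?case by simp
next
  case (step1 i)
  have "f (shift_map (shift_by i x)) = shift_map (f (shift_by i x))"
    by (rule f) (rule shift_by_mem[OF X x])
  then show ?case by (simp only: shift_map_shift_by step1)
next
  case (step2 i)
  have "f (shift_map (shift_by (i - 1) x)) = shift_map (f (shift_by (i - 1) x))"
    by (rule f) (rule shift_by_mem[OF X x])
  then have *: "shift_by i (f x) = shift_map (f (shift_by (i - 1) x))"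
    by (simp only: shift_map_shift_by step2 diff_add_cancel)
  have "f (shift_by (i - 1) x) l = f x (l + (i - 1))" for l
    using fun_cong[OF *, of "l - 1"] by (simp add: shift_map_def algebra_simps)
  then show ?case by (simp add: shift_by_def)
qed

section \<open>Topology of the full shift\<close>

lemma topspace_full_shift: "topspace (full_shift_topology A) = {x. range x \<subseteq> A}"
  by (auto simp: full_shift_topology_def PiE_def)

text \<open>A basic open set of the product constrains only finitely many coordinates, so it
  contains a central cylinder around each of its points.\<close>

lemma openin_full_shift_iff:
  "openin (full_shift_topology A) U \<longleftrightarrow>
     U \<subseteq> {x. range x \<subseteq> A} \<and>
     (\<forall>x\<in>U. \<exists>n. \<forall>z. range z \<subseteq> A \<and> (\<forall>i. \<bar>i\<bar> \<le> n \<longrightarrow> z i = x i) \<longrightarrow> z \<in> U)" (is "?L \<longleftrightarrow> ?R")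
proof
  assume L: ?L
  have "\<exists>n. \<forall>z. range z \<subseteq> A \<and> (\<forall>i. \<bar>i\<bar> \<le> n \<longrightarrow> z i = x i) \<longrightarrow> z \<in> U" if x: "x \<in> U" for x
  proof -
    obtain W where W: "finite {i. W i \<noteq> A}" "\<forall>i. W i \<subseteq> A" "x \<in> Pi\<^sub>E UNIV W" "Pi\<^sub>E UNIV W \<subseteq> U"
      using L x unfolding full_shift_topology_def openin_product_topology_alt by auto
    have "finite (abs ` {i. W i \<noteq> A})" using W(1) by simp
    then obtain n where n: "\<And>i. W i \<noteq> A \<Longrightarrow> \<bar>i\<bar> \<le> n"
      by (metis (mono_tags, lifting) Max_ge image_eqI mem_Collect_eq)
    have "z \<in> U" if z: "range z \<subseteq> A" "\<forall>i. \<bar>i\<bar> \<le> n \<longrightarrow> z i = x i" for z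
    proof -
      have "z i \<in> W i" for i
        using z W(3) n[of i] by (cases "W i = A") (auto simp: PiE_def Pi_def)
      then show ?thesis using W(4) by (auto simp: PiE_def Pi_def)
    qed
    then show ?thesis by blast
  qed
  then show ?R using openin_subset[OF L] by (auto simp: topspace_full_shift)
next
  assume R: ?R
  show ?L
  proof (subst openin_subopen, intro ballI)
    fix x assume x: "x \<in> U"
    then obtain n where n: "\<And>z. range z \<subseteq> A \<Longrightarrow> (\<forall>i. \<bar>i\<bar> \<le> n \<longrightarrow> z i = x i) \<Longrightarrow> z \<in> U"
      using R by meson
    have xA: "range x \<subseteq> A" using R x by blast
    define W where "W = (\<lambda>i. if \<bar>i\<bar> \<le> n then {x i} else A)"
    have "{i. W i \<noteq> A} \<subseteq> {-n..n}" by (auto simp: W_def split: if_splits)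
    then have "finite {i. W i \<noteq> A}" by (rule finite_subset) simp
    then have "openin (full_shift_topology A) (Pi\<^sub>E UNIV W)"
      unfolding full_shift_topology_def
      by (subst openin_PiE_gen) (use xA in \<open>auto simp: W_def\<close>)
    moreover have "x \<in> Pi\<^sub>E UNIV W" using xA by (auto simp: W_def)
    moreover have "Pi\<^sub>E UNIV W \<subseteq> U"
    proof
      fix z assume "z \<in> Pi\<^sub>E UNIV W"
      then have z: "z i \<in> W i" for i by auto
      have "z i \<in> A" for i using z[of i] xA by (auto simp: W_def split: if_splits)
      moreover have "z i = x i" if "\<bar>i\<bar> \<le> n" for i using z[of i] that by (simp add: W_def)
      ultimately show "z \<in> U" by (intro n) auto
    qed
    ultimately show "\<exists>T. openin (full_shift_topology A) T \<and> x \<in> T \<and> T \<subseteq> U" by blast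
  qed
qed

lemma openin_full_shiftD:
  assumes "openin (full_shift_topology A) U" "x \<in> U"
  obtains n where "\<And>z. range z \<subseteq> A \<Longrightarrow> (\<And>i. \<bar>i\<bar> \<le> n \<Longrightarrow> z i = x i) \<Longrightarrow> z \<in> U"
  using assms unfolding openin_full_shift_iff by meson

lemma compactin_shift_space:
  assumes "finite A" "closedin (full_shift_topology A) X"
  shows "compactin (full_shift_topology A) X"
proof (rule closedin_compact_space[OF _ assms(2)])
  show "compact_space (full_shift_topology A)"
    unfolding full_shift_topology_def compact_space_product_topology
    using assms(1) by (auto simp: compact_space_discrete_topology)
qed

lemma closedin_full_shift_mem:
  assumes X: "closedin (full_shift_topology A) X"
    and x: "\<And>n. \<exists>z\<in>X. \<forall>i. \<bar>i\<bar> \<le> n \<longrightarrow> z i = x i"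
  shows "x \<in> X"
proof (rule ccontr)
  assume nx: "x \<notin> X"
  have sub: "X \<subseteq> {x. range x \<subseteq> A}"
    using closedin_subset[OF X] by (simp add: topspace_full_shift)
  have "x i \<in> A" for i
  proof -
    obtain z where "z \<in> X" "\<forall>l. \<bar>l\<bar> \<le> \<bar>i\<bar> \<longrightarrow> z l = x l" using x by blast
    then have "x i = z i" by simp
    moreover have "z i \<in> A" using sub \<open>z \<in> X\<close> by blast
    ultimately show ?thesis by simp
  qed
  then have "x \<in> {x. range x \<subseteq> A} - X" using nx by blast
  moreover have "openin (full_shift_topology A) ({x. range x \<subseteq> A} - X)"
    using X by (metis closedin_def topspace_full_shift)
  ultimately obtain n where
    n: "\<And>z. range z \<subseteq> A \<Longrightarrow> (\<And>i. \<bar>i\<bar> \<le> n \<Longrightarrow> z i = x i) \<Longrightarrow> z \<in> {x. range x \<subseteq> A} - X"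
    using openin_full_shiftD by metis
  obtain z where z: "z \<in> X" "\<forall>i. \<bar>i\<bar> \<le> n \<longrightarrow> z i = x i" using x by blast
  then have "z \<in> {x. range x \<subseteq> A} - X" using sub by (intro n) auto
  then show False using z by simp
qed

section \<open>Sliding block codes\<close>

definition block_code :: "int \<Rightarrow> (int \<Rightarrow> 'a) set \<Rightarrow> ((int \<Rightarrow> 'a) \<Rightarrow> int \<Rightarrow> 'b) \<Rightarrow> bool" where
  "block_code m X f \<longleftrightarrow> 0 \<le> m \<and>
     (\<forall>x\<in>X. \<forall>z\<in>X. \<forall>i. (\<forall>j. i - m \<le> j \<and> j \<le> i + m \<longrightarrow> x j = z j) \<longrightarrow> f x i = f z i)"

lemma block_codeD:
  assumes "block_code m X f" "x \<in> X" "z \<in> X" "\<And>j. i - m \<le> j \<Longrightarrow> j \<le> i + m \<Longrightarrow> x j = z j"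
  shows "f x i = f z i"
  using assms unfolding block_code_def by blast

lemma block_code_mono:
  assumes "block_code m X f" "m \<le> n"
  shows "block_code n X f"
  unfolding block_code_def
proof (intro conjI ballI allI impI)
  show "0 \<le> n" using assms by (simp add: block_code_def)
next
  fix x z i assume xz: "x \<in> X" "z \<in> X" "\<forall>j. i - n \<le> j \<and> j \<le> i + n \<longrightarrow> x j = z j"
  show "f x i = f z i"
    by (rule block_codeD[OF assms(1) xz(1,2)]) (use xz(3) assms(2) in auto)
qed

text \<open>Continuity makes coordinate 0 of the image locally constant, compactness of
  \<open>X\<close> makes the radius uniform, and equivariance carries the bound from coordinate 0 to
  every \<open>i\<close>.\<close>

lemma curtis_hedlund_lyndon:
  assumes X: "shift_space A X" and Y: "shift_space B Y"
    and f: "continuous_map (shift_topology A X) (shift_topology B Y) f"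
    and eq: "\<And>x. x \<in> X \<Longrightarrow> f (shift_map x) = shift_map (f x)"
  shows "\<exists>m. block_code m X f"
proof -
  let ?T = "full_shift_topology A"
  have clX: "closedin ?T X" and fA: "finite A" and sX: "shift_map ` X = X"
    using X by (auto simp: shift_space_def)
  have subX: "X \<subseteq> {x. range x \<subseteq> A}" using closedin_subset[OF clX] by (simp add: topspace_full_shift)
  have topX: "topspace (shift_topology A X) = X"
    using subX by (auto simp: topspace_full_shift)
  have subY: "Y \<subseteq> {x. range x \<subseteq> B}"
    using Y closedin_subset[of "full_shift_topology B" Y] by (simp add: topspace_full_shift shift_space_def)
  have topY: "topspace (shift_topology B Y) = Y"
    using subY by (auto simp: topspace_full_shift)
  have fY: "f x \<in> Y" if "x \<in> X" for x using f that topX topY by (auto simp: continuous_map_def Pi_def)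
  have loc: "\<exists>n. \<forall>z\<in>X. (\<forall>i. \<bar>i\<bar> \<le> n \<longrightarrow> z i = x i) \<longrightarrow> f z 0 = f x 0" if x: "x \<in> X" for x
  proof -
    have "openin (full_shift_topology B) {y. range y \<subseteq> B \<and> y 0 = f x 0}"
      unfolding openin_full_shift_iff by (auto intro!: exI[of _ 0])
    then have "openin (shift_topology B Y) (Y \<inter> {y. range y \<subseteq> B \<and> y 0 = f x 0})"
      unfolding openin_subtopology by (intro exI[of _ "{y. range y \<subseteq> B \<and> y 0 = f x 0}"]) auto
    then have "openin (shift_topology A X) {z \<in> X. f z \<in> Y \<inter> {y. range y \<subseteq> B \<and> y 0 = f x 0}}"
      using f unfolding continuous_map_def topX by (auto simp only: mem_Collect_eq)
    then obtain U where U: "openin ?T U"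
      "{z \<in> X. f z \<in> Y \<inter> {y. range y \<subseteq> B \<and> y 0 = f x 0}} = U \<inter> X"
      unfolding openin_subtopology by blast
    have "x \<in> U" using U(2) x fY[OF x] subY by blast
    then obtain n where n: "\<And>z. range z \<subseteq> A \<Longrightarrow> (\<And>i. \<bar>i\<bar> \<le> n \<Longrightarrow> z i = x i) \<Longrightarrow> z \<in> U"
      using openin_full_shiftD[OF U(1)] by metis
    have "f z 0 = f x 0" if z: "z \<in> X" "\<forall>i. \<bar>i\<bar> \<le> n \<longrightarrow> z i = x i" for z
    proof -
      have "z \<in> U" by (rule n) (use z subX in auto)
      then have "z \<in> U \<inter> X" using z by simp
      then show ?thesis unfolding U(2)[symmetric] by blast
    qed
    then show ?thesis by blast
  qed
  then obtain n where n: "\<And>x z. x \<in> X \<Longrightarrow> z \<in> X \<Longrightarrow> (\<forall>i. \<bar>i\<bar> \<le> n x \<longrightarrow> z i = x i) \<Longrightarrow> f z 0 = f x 0"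
    by metis
  define N where "N = (\<lambda>x. {z. range z \<subseteq> A \<and> (\<forall>i. \<bar>i\<bar> \<le> n x \<longrightarrow> z i = x i)})"
  have "openin ?T (N x)" for x unfolding openin_full_shift_iff N_def
    by (auto intro!: exI[of _ "n x"])
  moreover have "X \<subseteq> \<Union> (N ` X)" using subX by (auto simp: N_def)
  ultimately obtain \<F> where F: "finite \<F>" "\<F> \<subseteq> N ` X" "X \<subseteq> \<Union>\<F>"
    using compactin_shift_space[OF fA clX] unfolding compactin_def by (metis (no_types, lifting) imageE)
  then obtain S where S: "finite S" "S \<subseteq> X" "\<F> = N ` S" by (meson finite_subset_image)
  \<comment> \<open>The inserted 0 covers an empty \<open>S\<close>, which occurs for empty
    \<open>X\<close>, and yields \<open>0 \<le> m\<close>.\<close>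
  define m where "m = Max (insert 0 (n ` S))"
  have m: "0 \<le> m" "x \<in> S \<Longrightarrow> n x \<le> m" for x using S(1) by (auto simp: m_def)
  have zero: "f z 0 = f z' 0"
    if zz: "z \<in> X" "z' \<in> X" "\<And>j. - m \<le> j \<Longrightarrow> j \<le> m \<Longrightarrow> z j = z' j" for z z'
  proof -
    obtain x where x: "x \<in> S" "z \<in> N x" using F(3) S(3) zz(1) by blast
    have "f z 0 = f x 0" by (rule n) (use x S zz in \<open>auto simp: N_def\<close>)
    moreover have "f z' 0 = f x 0"
    proof (rule n)
      show "\<forall>i. \<bar>i\<bar> \<le> n x \<longrightarrow> z' i = x i"
      proof (intro allI impI)
        fix i assume i: "\<bar>i\<bar> \<le> n x"
        then have "z i = z' i" using m(2)[OF x(1)] by (intro zz) auto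
        then show "z' i = x i" using x(2) i by (simp add: N_def)
      qed
    qed (use x S zz in auto)
    ultimately show ?thesis by simp
  qed
  have "f z i = f z' i"
    if zz: "z \<in> X" "z' \<in> X" "\<And>j. i - m \<le> j \<Longrightarrow> j \<le> i + m \<Longrightarrow> z j = z' j" for z z' i
  proof -
    have "f (shift_by i z) 0 = f (shift_by i z') 0"
      by (rule zero) (auto intro!: shift_by_mem[OF sX] zz)
    then show ?thesis using equivariant_shift_by[where f = f, OF sX eq] zz by simp
  qed
  then have "block_code m X f" unfolding block_code_def using m(1) by blast
  then show ?thesis ..
qed

section \<open>A preorder on the points of a shift space\<close>

definition splice_at :: "int \<Rightarrow> (int \<Rightarrow> 'a) \<Rightarrow> (int \<Rightarrow> 'a) \<Rightarrow> int \<Rightarrow> 'a" where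
  "splice_at j x z = (\<lambda>i. if i < j then x i else z i)"

text \<open>Equality of the predecessor sets of the right-rays starting at \<open>j\<close>, as
  \<open>vertex_at_eq_iff\<close> shows. It is phrased with whole points so that maps between shift
  spaces apply to the splices directly; only the part of \<open>w\<close> left of \<open>j\<close>
  enters.\<close>

definition same_past :: "(int \<Rightarrow> 'a) set \<Rightarrow> int \<Rightarrow> (int \<Rightarrow> 'a) \<Rightarrow> (int \<Rightarrow> 'a) \<Rightarrow> bool" where
  "same_past X j x z \<longleftrightarrow> (\<forall>w. splice_at j w x \<in> X \<longleftrightarrow> splice_at j w z \<in> X)"

text \<open>Agreement left of \<open>j\<close> lets the cut move further left: a past at a smaller
  cut, followed by the common segment, is a past at \<open>j\<close>.\<close>

definition left_equivalent :: "(int \<Rightarrow> 'a) set \<Rightarrow> (int \<Rightarrow> 'a) \<Rightarrow> (int \<Rightarrow> 'a) \<Rightarrow> bool" where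
  "left_equivalent X x z \<longleftrightarrow> (\<exists>j. (\<forall>i<j. x i = z i) \<and> same_past X j x z)"

text \<open>A witness for \<open>n\<close> serves every larger \<open>n\<close>, so the content lies
  in \<open>n\<close> tending to minus infinity. The shift \<open>k\<close> is free because a path
  from the left end of \<open>x\<close> to that of \<open>z\<close> may have any length.\<close>

definition leads_to :: "(int \<Rightarrow> 'a) set \<Rightarrow> (int \<Rightarrow> 'a) \<Rightarrow> (int \<Rightarrow> 'a) \<Rightarrow> bool" where
  "leads_to X x z \<longleftrightarrow>
     (\<forall>n. \<exists>k. \<exists>u\<in>X. left_equivalent X u (shift_by k x) \<and> (\<forall>i\<ge>n. u i = z i))"

section \<open>Invariance of the preorder under conjugacy\<close>

lemma same_past_mono:
  assumes "same_past X j x z" "\<And>i. i < j \<Longrightarrow> x i = z i" "l \<le> j"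
  shows "same_past X l x z"
  unfolding same_past_def
proof
  fix w
  have "splice_at l w x = splice_at j (splice_at l w x) x" "splice_at l w z = splice_at j (splice_at l w x) z"
    using assms(2,3) by (auto simp: splice_at_def)
  then show "splice_at l w x \<in> X \<longleftrightarrow> splice_at l w z \<in> X"
    using assms(1) unfolding same_past_def by metis
qed

lemma left_equivalentE:
  assumes "left_equivalent X x z"
  obtains j where "j \<le> n" "\<And>i. i < j \<Longrightarrow> x i = z i" "same_past X j x z"
proof -
  obtain j where j: "\<forall>i<j. x i = z i" "same_past X j x z"
    using assms by (auto simp: left_equivalent_def)
  show ?thesis
    by (rule that[of "min j n"]) (use j in \<open>auto intro: same_past_mono\<close>)
qed

text \<open>Each application of a code costs \<open>m\<close> coordinates. Since the preimage
  \<open>u\<close> of the given splice agrees with \<open>x\<close> from \<open>j - 2 * m\<close>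
  on, its right-ray at \<open>j\<close> may be replaced by that of \<open>z\<close>. The image of
  the result is the wanted splice: left of \<open>j - m\<close> the window sees only
  \<open>u\<close>, and from \<open>j - m\<close> on it sees only \<open>z\<close>. Between
  \<open>j - 3 * m\<close> and \<open>j - m\<close> the images of \<open>x\<close> and
  \<open>z\<close> coincide, as \<open>x\<close> and \<open>z\<close> agree left of
  \<open>j\<close>.\<close>

lemma splice_at_image:
  assumes f: "block_code m X f" and g: "block_code m Y g"
    and fX: "f ` X \<subseteq> Y" and gY: "g ` Y \<subseteq> X"
    and gf: "\<And>x. x \<in> X \<Longrightarrow> g (f x) = x" and fg: "\<And>y. y \<in> Y \<Longrightarrow> f (g y) = y"
    and x: "x \<in> X" and z: "z \<in> X"
    and agree: "\<And>i. i < j \<Longrightarrow> x i = z i"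
    and past: "\<And>w. splice_at j w x \<in> X \<Longrightarrow> splice_at j w z \<in> X"
    and v: "splice_at (j - 3 * m) w (f x) \<in> Y"
  shows "splice_at (j - 3 * m) w (f z) \<in> Y"
proof -
  have m: "0 \<le> m" using f by (simp add: block_code_def)
  define v where "v = splice_at (j - 3 * m) w (f x)"
  have vY: "v \<in> Y" using assms(11) by (simp add: v_def)
  define u where "u = g v"
  have uX: "u \<in> X" using vY gY by (auto simp: u_def)
  have u_x: "u i = x i" if "i \<ge> j - 2 * m" for i
  proof -
    have "g v i = g (f x) i"
      by (rule block_codeD[OF g vY]) (use fX x that m in \<open>auto simp: v_def splice_at_def\<close>)
    then show ?thesis using gf x by (simp add: u_def)
  qed
  have "splice_at j u x = u" using u_x m by (auto simp: splice_at_def)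
  then have u'X: "splice_at j u z \<in> X" using past[of u] uX by simp
  have u'_z: "splice_at j u z i = z i" if "i \<ge> j - 2 * m" for i
    using that u_x agree by (auto simp: splice_at_def)
  have "f (splice_at j u z) i = splice_at (j - 3 * m) w (f z) i" for i
  proof (cases "i < j - m")
    case True
    have "f (splice_at j u z) i = f u i"
      by (rule block_codeD[OF f u'X uX]) (use True in \<open>auto simp: splice_at_def\<close>)
    also have "f u i = v i" using fg vY by (simp add: u_def)
    also have "v i = splice_at (j - 3 * m) w (f z) i"
    proof -
      have "f x i = f z i"
        by (rule block_codeD[OF f x z]) (use True agree in auto)
      then show ?thesis by (simp add: v_def splice_at_def)
    qed
    finally show ?thesis .
  next
    case False
    have "f (splice_at j u z) i = f z i"
      by (rule block_codeD[OF f u'X z]) (use False u'_z in auto)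
    then show ?thesis using False m by (simp add: splice_at_def)
  qed
  then have "f (splice_at j u z) = splice_at (j - 3 * m) w (f z)" by blast
  then show ?thesis using u'X fX by (metis image_subset_iff)
qed

lemma left_equivalent_image:
  assumes f: "block_code m X f" and g: "block_code m Y g"
    and fX: "f ` X \<subseteq> Y" and gY: "g ` Y \<subseteq> X"
    and gf: "\<And>x. x \<in> X \<Longrightarrow> g (f x) = x" and fg: "\<And>y. y \<in> Y \<Longrightarrow> f (g y) = y"
    and x: "x \<in> X" and z: "z \<in> X"
    and xz: "left_equivalent X x z"
  shows "left_equivalent Y (f x) (f z)"
proof -
  have m: "0 \<le> m" using f by (simp add: block_code_def)
  obtain j where agree: "\<And>i. i < j \<Longrightarrow> x i = z i" and past: "same_past X j x z"
    by (rule left_equivalentE[OF xz]) blast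
  have "f x i = f z i" if "i < j - 3 * m" for i
    by (rule block_codeD[OF f x z]) (use that agree m in auto)
  moreover have "same_past Y (j - 3 * m) (f x) (f z)"
    unfolding same_past_def
  proof (intro allI iffI)
    fix w
    show "splice_at (j - 3 * m) w (f z) \<in> Y" if "splice_at (j - 3 * m) w (f x) \<in> Y"
      by (rule splice_at_image[OF f g fX gY gf fg x z agree _ that])
        (use past in \<open>simp_all add: same_past_def\<close>)
    show "splice_at (j - 3 * m) w (f x) \<in> Y" if "splice_at (j - 3 * m) w (f z) \<in> Y"
      by (rule splice_at_image[OF f g fX gY gf fg z x agree[symmetric] _ that])
        (use past in \<open>simp_all add: same_past_def\<close>)
  qed
  ultimately show ?thesis unfolding left_equivalent_def by blast
qed

lemma leads_to_image:
  assumes f: "block_code m X f" and g: "block_code m Y g"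
    and fX: "f ` X \<subseteq> Y" and gY: "g ` Y \<subseteq> X"
    and gf: "\<And>x. x \<in> X \<Longrightarrow> g (f x) = x" and fg: "\<And>y. y \<in> Y \<Longrightarrow> f (g y) = y"
    and eq: "\<And>x k. x \<in> X \<Longrightarrow> f (shift_by k x) = shift_by k (f x)"
    and X: "shift_map ` X = X"
    and x: "x \<in> X" and z: "z \<in> X" and xz: "leads_to X x z"
  shows "leads_to Y (f x) (f z)"
  unfolding leads_to_def
proof
  fix n
  \<comment> \<open>Starting the agreement at \<open>n - m\<close> covers the window of
    \<open>f\<close> at every coordinate from \<open>n\<close> on.\<close>
  obtain k u where u: "u \<in> X" "left_equivalent X u (shift_by k x)" "\<forall>i\<ge>n - m. u i = z i"
    using xz unfolding leads_to_def by blast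
  have "left_equivalent Y (f u) (f (shift_by k x))"
    by (rule left_equivalent_image[OF f g fX gY gf fg u(1) shift_by_mem[OF X x] u(2)])
  moreover have "f u i = f z i" if "i \<ge> n" for i
    by (rule block_codeD[OF f u(1) z]) (use u(3) that in auto)
  ultimately show "\<exists>k. \<exists>v\<in>Y. left_equivalent Y v (shift_by k (f x)) \<and> (\<forall>i\<ge>n. v i = f z i)"
    using u(1) fX eq[OF x] by (intro exI[of _ k] bexI[of _ "f u"]) auto
qed

text \<open>Comparing the preorders through a relation rather than a map avoids choosing, for symbol
  expansions, one of the shifts of an expanded point.\<close>

definition leads_to_correspondence ::
    "(int \<Rightarrow> 'a) set \<Rightarrow> (int \<Rightarrow> 'b) set \<Rightarrow> ((int \<Rightarrow> 'a) \<Rightarrow> (int \<Rightarrow> 'b) \<Rightarrow> bool) \<Rightarrow> bool" where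
  "leads_to_correspondence X Y R \<longleftrightarrow>
     (\<forall>x\<in>X. \<exists>y\<in>Y. R x y) \<and> (\<forall>y\<in>Y. \<exists>x\<in>X. R x y) \<and>
     (\<forall>x\<in>X. \<forall>z\<in>X. \<forall>y\<in>Y. \<forall>w\<in>Y. R x y \<longrightarrow> R z w \<longrightarrow> leads_to X x z = leads_to Y y w)"

definition leads_to_equiv :: "(int \<Rightarrow> 'a) set \<Rightarrow> (int \<Rightarrow> 'b) set \<Rightarrow> bool" where
  "leads_to_equiv X Y \<longleftrightarrow> (\<exists>R. leads_to_correspondence X Y R)"

lemma leads_to_equivI: "leads_to_correspondence X Y R \<Longrightarrow> leads_to_equiv X Y"
  unfolding leads_to_equiv_def by (rule exI[of _ R])

lemma leads_to_correspondenceI: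
  assumes "\<And>x. x \<in> X \<Longrightarrow> \<exists>y\<in>Y. R x y" "\<And>y. y \<in> Y \<Longrightarrow> \<exists>x\<in>X. R x y"
    and "\<And>x z y w. x \<in> X \<Longrightarrow> z \<in> X \<Longrightarrow> y \<in> Y \<Longrightarrow> w \<in> Y \<Longrightarrow> R x y \<Longrightarrow> R z w \<Longrightarrow>
           leads_to X x z = leads_to Y y w"
  shows "leads_to_correspondence X Y R"
  using assms unfolding leads_to_correspondence_def by simp

lemma leads_to_correspondenceD:
  assumes "leads_to_correspondence X Y R"
  shows "x \<in> X \<Longrightarrow> \<exists>y\<in>Y. R x y" "y \<in> Y \<Longrightarrow> \<exists>x\<in>X. R x y"
    and "x \<in> X \<Longrightarrow> z \<in> X \<Longrightarrow> y \<in> Y \<Longrightarrow> w \<in> Y \<Longrightarrow> R x y \<Longrightarrow> R z w \<Longrightarrow>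
           leads_to X x z = leads_to Y y w"
  using assms unfolding leads_to_correspondence_def by simp_all

lemma leads_to_equiv_refl: "leads_to_equiv X X"
  unfolding leads_to_equiv_def
  by (intro exI[of _ "(=)"] leads_to_correspondenceI) auto

lemma leads_to_equiv_sym:
  assumes "leads_to_equiv X Y"
  shows "leads_to_equiv Y X"
proof -
  obtain R where R: "leads_to_correspondence X Y R"
    using assms unfolding leads_to_equiv_def ..
  have "leads_to_correspondence Y X (\<lambda>y x. R x y)"
    by (rule leads_to_correspondenceI)
      (use R in \<open>simp_all add: leads_to_correspondenceD(1,2)[OF R] leads_to_correspondenceD(3)[OF R, symmetric]\<close>)
  then show ?thesis by (rule leads_to_equivI)
qed

lemma leads_to_equiv_trans:
  assumes "leads_to_equiv X Y" "leads_to_equiv Y Z"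
  shows "leads_to_equiv X Z"
proof -
  obtain R where R: "leads_to_correspondence X Y R"
    using assms(1) unfolding leads_to_equiv_def ..
  obtain S where S: "leads_to_correspondence Y Z S"
    using assms(2) unfolding leads_to_equiv_def ..
  have "leads_to_correspondence X Z (\<lambda>x z. \<exists>y\<in>Y. R x y \<and> S y z)"
  proof (rule leads_to_correspondenceI)
    show "\<exists>z\<in>Z. \<exists>y\<in>Y. R x y \<and> S y z" if "x \<in> X" for x
      using leads_to_correspondenceD(1)[OF R that] leads_to_correspondenceD(1)[OF S] by blast
    show "\<exists>x\<in>X. \<exists>y\<in>Y. R x y \<and> S y z" if "z \<in> Z" for z
      using leads_to_correspondenceD(2)[OF S that] leads_to_correspondenceD(2)[OF R] by blast
  next
    fix x z u v assume *: "x \<in> X" "z \<in> X" "u \<in> Z" "v \<in> Z"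
      "\<exists>y\<in>Y. R x y \<and> S y u" "\<exists>w\<in>Y. R z w \<and> S w v"
    then obtain y w where yw: "y \<in> Y" "R x y" "S y u" "w \<in> Y" "R z w" "S w v" by blast
    show "leads_to X x z = leads_to Z u v"
      using leads_to_correspondenceD(3)[OF R, OF *(1,2) yw(1,4,2,5)]
        leads_to_correspondenceD(3)[OF S, OF yw(1,4) *(3,4) yw(3,6)] by simp
  qed
  then show ?thesis by (rule leads_to_equivI)
qed

lemma conjugate_imp_leads_to_equiv:
  assumes "conjugate A X B Y"
  shows "leads_to_equiv X Y"
proof -
  have X: "shift_space A X" and Y: "shift_space B Y" using assms by (auto simp: conjugate_def)
  have sX: "shift_map ` X = X" and sY: "shift_map ` Y = Y"
    using X Y by (auto simp: shift_space_def)
  obtain f where f: "homeomorphic_map (shift_topology A X) (shift_topology B Y) f"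
    and eq: "\<And>x. x \<in> X \<Longrightarrow> f (shift_map x) = shift_map (f x)"
    using assms by (auto simp: conjugate_def)
  obtain g where fg: "homeomorphic_maps (shift_topology A X) (shift_topology B Y) f g"
    using f by (auto simp: homeomorphic_map_maps)
  have topX: "topspace (shift_topology A X) = X" and topY: "topspace (shift_topology B Y) = Y"
    using X Y closedin_subset by (fastforce simp: shift_space_def)+
  have fc: "continuous_map (shift_topology A X) (shift_topology B Y) f"
    and gc: "continuous_map (shift_topology B Y) (shift_topology A X) g"
    and gf: "\<And>x. x \<in> X \<Longrightarrow> g (f x) = x" and fg: "\<And>y. y \<in> Y \<Longrightarrow> f (g y) = y"
    using fg unfolding homeomorphic_maps_def topX topY by auto
  have fX: "f ` X \<subseteq> Y" and gY: "g ` Y \<subseteq> X"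
    using continuous_map_image_subset_topspace[OF fc] continuous_map_image_subset_topspace[OF gc]
    unfolding topX topY by auto
  have geq: "g (shift_map y) = shift_map (g y)" if y: "y \<in> Y" for y
  proof -
    have gy: "g y \<in> X" using gY y by blast
    then have "shift_map (g y) \<in> X" using sX by blast
    then have "shift_map (g y) = g (f (shift_map (g y)))" by (simp add: gf)
    also have "\<dots> = g (shift_map y)" using eq[OF gy] fg[OF y] by simp
    finally show ?thesis by simp
  qed
  obtain m1 where m1: "block_code m1 X f" using curtis_hedlund_lyndon[OF X Y fc eq] by blast
  obtain m2 where m2: "block_code m2 Y g" using curtis_hedlund_lyndon[OF Y X gc geq] by blast
  have m: "block_code (max m1 m2) X f" "block_code (max m1 m2) Y g"
    using m1 m2 by (auto elim: block_code_mono)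
  note eqs = equivariant_shift_by[where f = f, OF sX eq] equivariant_shift_by[where f = g, OF sY geq]
  have "leads_to_correspondence X Y (\<lambda>x y. f x = y)"
  proof (rule leads_to_correspondenceI)
    show "\<exists>y\<in>Y. f x = y" if "x \<in> X" for x using fX that by blast
    show "\<exists>x\<in>X. f x = y" if "y \<in> Y" for y using gY fg that by blast
  next
    fix x z y w assume *: "x \<in> X" "z \<in> X" "y \<in> Y" "w \<in> Y" "f x = y" "f z = w"
    show "leads_to X x z = leads_to Y y w"
    proof
      show "leads_to Y y w" if "leads_to X x z"
        using leads_to_image[OF m fX gY gf fg eqs(1) sX *(1,2) that] * by simp
      show "leads_to X x z" if "leads_to Y y w"
        using leads_to_image[OF m(2,1) gY fX fg gf eqs(2) sY *(3,4) that] * gf by auto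
    qed
  qed
  then show ?thesis by (rule leads_to_equivI)
qed

section \<open>Symbol expansion\<close>

lemma occurs_in_iff: "occurs_in w x \<longleftrightarrow> (\<exists>i. \<forall>k<length w. w ! k = x (i + int k))"
proof
  assume "occurs_in w x"
  then obtain i j where w: "w = map x [i..j]" by (auto simp: occurs_in_def)
  then have "\<forall>k<length w. w ! k = x (i + int k)" by auto
  then show "\<exists>i. \<forall>k<length w. w ! k = x (i + int k)" ..
next
  assume "\<exists>i. \<forall>k<length w. w ! k = x (i + int k)"
  then obtain i where i: "\<forall>k<length w. w ! k = x (i + int k)" ..
  then have "w = map x [i..i + int (length w) - 1]"
    by (intro nth_equalityI) auto
  then show "occurs_in w x" unfolding occurs_in_def by blast
qed

lemma map_upto_language: "x \<in> X \<Longrightarrow> map x [i..j] \<in> language X"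
  by (auto simp: language_def occurs_in_def)

lemma sublist_language:
  assumes "w \<in> language X" "sublist u w"
  shows "u \<in> language X"
proof -
  obtain ps ss where w: "w = ps @ u @ ss" using assms(2) by (auto simp: sublist_def)
  obtain x i where x: "x \<in> X" "\<And>k. k < length w \<Longrightarrow> w ! k = x (i + int k)"
    using assms(1) by (auto simp: language_def occurs_in_iff)
  have "u ! k = x (i + int (length ps) + int k)" if "k < length u" for k
    using x(2)[of "length ps + k"] that by (simp add: w nth_append add.assoc)
  then show ?thesis using x(1) by (auto simp: language_def occurs_in_iff)
qed

text \<open>A word occurring anywhere can be shifted to the centre, and closedness then passes to
  the limit. This gives access to the points of an expanded shift, which is described by its
  language alone.\<close>

lemma shift_space_mem_iff_language:
  assumes "shift_space A X"
  shows "x \<in> X \<longleftrightarrow> (\<forall>n\<ge>0. map x [-n..n] \<in> language X)"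
proof
  show "\<forall>n\<ge>0. map x [-n..n] \<in> language X" if "x \<in> X"
    using that map_upto_language by blast
next
  assume *: "\<forall>n\<ge>0. map x [-n..n] \<in> language X"
  have "\<exists>z\<in>X. \<forall>i. \<bar>i\<bar> \<le> n \<longrightarrow> z i = x i" for n
  proof -
    have "map x [-\<bar>n\<bar>..\<bar>n\<bar>] \<in> language X" using * by simp
    then obtain z i where z: "z \<in> X"
      "\<And>k. k < nat (2 * \<bar>n\<bar> + 1) \<Longrightarrow> map x [-\<bar>n\<bar>..\<bar>n\<bar>] ! k = z (i + int k)"
      by (auto simp: language_def occurs_in_iff)
    have "shift_by (i + \<bar>n\<bar>) z l = x l" if "\<bar>l\<bar> \<le> n" for l
    proof -
      have "z (i + int (nat (l + \<bar>n\<bar>))) = x l"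
        using z(2)[of "nat (l + \<bar>n\<bar>)"] that by auto
      moreover have "0 \<le> l + \<bar>n\<bar>" using that by simp
      ultimately show ?thesis by (simp add: algebra_simps)
    qed
    moreover have "shift_by (i + \<bar>n\<bar>) z \<in> X"
      using assms z(1) by (intro shift_by_mem) (auto simp: shift_space_def)
    ultimately show ?thesis by blast
  qed
  then show "x \<in> X" using assms closedin_full_shift_mem by (metis shift_space_def)
qed

section \<open>Expansion of words and of points\<close>

lemma expand_word_simps [simp]:
  "expand_word a s [] = []"
  "expand_word a s (c # w) = (if c = a then a # s # expand_word a s w else c # expand_word a s w)"
  "expand_word a s (u @ w) = expand_word a s u @ expand_word a s w"
  by (simp_all add: expand_word_def)

lemma filter_expand_word:
  assumes "a \<noteq> s" "s \<notin> set w"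
  shows "filter (\<lambda>c. c \<noteq> s) (expand_word a s w) = w"
  using assms by (induction w) auto

text \<open>The first conjunct carries the induction: the expansion of the rest must not begin with
  \<open>s\<close>, or a letter other than \<open>a\<close> would come to stand before a
  marker.\<close>

lemma expand_word_nth:
  assumes "a \<noteq> s" "s \<notin> set w"
  shows "(0 < length (expand_word a s w) \<longrightarrow> expand_word a s w ! 0 \<noteq> s) \<and>
    (\<forall>k. Suc k < length (expand_word a s w) \<longrightarrow>
      (expand_word a s w ! k = a \<longleftrightarrow> expand_word a s w ! Suc k = s))"
  using assms(2)
proof (induction w)
  case (Cons c w)
  then show ?case using assms(1)
    by (auto simp: nth_Cons split: nat.splits)
qed simp

text \<open>\<open>p i\<close> is the position in \<open>y\<close> of the letter \<open>x i\<close>.\<close>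

definition expands ::
    "'a \<Rightarrow> 'a \<Rightarrow> (int \<Rightarrow> int) \<Rightarrow> (int \<Rightarrow> 'a) \<Rightarrow> (int \<Rightarrow> 'a) \<Rightarrow> bool" where
  "expands a s p x y \<longleftrightarrow> s \<notin> range x \<and> (\<forall>i. p (i + 1) = p i + (if x i = a then 2 else 1)) \<and>
     (\<forall>i. y (p i) = x i) \<and> (\<forall>i. x i = a \<longrightarrow> y (p i + 1) = s)"

lemma int_steps_le:
  fixes p :: "int \<Rightarrow> int"
  assumes "\<And>i. p i + 1 \<le> p (i + 1)" "i \<le> j"
  shows "p i + (j - i) \<le> p j"
  using assms(2)
proof (induction j rule: int_ge_induct)
  case (step j)
  then show ?case using assms(1)[of j] by simp
qed simp

context
  fixes a s :: 'a and p x y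
  assumes e: "expands a s p x y"
begin

lemma expands_fresh: "x i \<noteq> s"
  using e by (auto simp: expands_def)

lemma expands_step: "p (i + 1) = p i + (if x i = a then 2 else 1)"
  using e by (auto simp: expands_def)

lemma expands_at: "y (p i) = x i"
  using e by (auto simp: expands_def)

lemma expands_at_Suc: "x i = a \<Longrightarrow> y (p i + 1) = s"
  using e by (auto simp: expands_def)

lemma expands_le: "i \<le> j \<Longrightarrow> p i + (j - i) \<le> p j"
  by (rule int_steps_le) (simp_all add: expands_step)

lemma expands_less: "i < j \<Longrightarrow> p i + (if x i = a then 2 else 1) \<le> p j"
  using expands_le[of "i + 1" j] expands_step[of i] by simp

lemma expands_less_iff: "p i < p j \<longleftrightarrow> i < j"
  using expands_le[of i j] expands_le[of j i] by linarith

lemma expands_cover_right: "p j \<le> l \<Longrightarrow> \<exists>i\<ge>j. l = p i \<or> x i = a \<and> l = p i + 1"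
proof (induction l rule: int_ge_induct)
  case (step l)
  then obtain i where i: "i \<ge> j" "l = p i \<or> x i = a \<and> l = p i + 1" by blast
  show ?case
  proof (cases "l = p i \<and> x i = a")
    case True
    then show ?thesis using i by auto
  next
    case False
    then have "l + 1 = p (i + 1)" using i(2) expands_step[of i] by auto
    then show ?thesis using i(1) by (intro exI[of _ "i + 1"]) auto
  qed
qed auto

lemma expands_cover: "\<exists>i. l = p i \<or> x i = a \<and> l = p i + 1"
proof -
  \<comment> \<open>Each step of \<open>p\<close> is at least 1, so going left from 0 by the excess
    of \<open>p 0\<close> over \<open>l\<close> brings \<open>p\<close> down to \<open>l\<close> or
    below. The same witness recurs below.\<close>
  have "p (min 0 (l - p 0)) \<le> l" using expands_le[of "min 0 (l - p 0)" 0] by linarith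
  then show ?thesis using expands_cover_right by blast
qed

lemma expands_cover_left: "l < p j \<Longrightarrow> \<exists>i<j. l = p i \<or> x i = a \<and> l = p i + 1"
  using expands_cover[of l] expands_less_iff expands_le[of j] by (smt (verit))

lemma expands_mem_range: "y l \<noteq> s \<Longrightarrow> \<exists>i. l = p i"
  using expands_cover[of l] expands_at_Suc by auto

text \<open>The position map absorbs both offsets, so a point and its expansion may be shifted
  independently. The amounts must differ in general, because a shift by one letter can move the
  expansion by two.\<close>

lemma expands_shift: "expands a s (\<lambda>i. p (i + k) - l) (shift_by k x) (shift_by l y)"
  unfolding expands_def
proof (intro conjI allI impI)
  fix i
  show "p (i + 1 + k) - l = p (i + k) - l + (if shift_by k x i = a then 2 else 1)"
    using expands_step[of "i + k"] by (simp add: algebra_simps)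
  show "shift_by l y (p (i + k) - l) = shift_by k x i" by (simp add: expands_at)
  show "shift_by l y (p (i + k) - l + 1) = s" if "shift_by k x i = a"
    using expands_at_Suc[of "i + k"] that by (simp add: algebra_simps)
qed (use expands_fresh in \<open>auto simp: image_iff\<close>)

lemma expands_word: "map y [p i..p (i + int n) - 1] = expand_word a s (map x [i..i + int n - 1])"
proof (induction n)
  case (Suc n)
  let ?k = "i + int n"
  have "p i \<le> p ?k" using expands_le[of i ?k] by simp
  then have "[p i..p (?k + 1) - 1] = [p i..p ?k - 1] @ [p ?k..p (?k + 1) - 1]"
    using expands_step[of ?k] by (intro upto_split1) (auto split: if_splits)
  moreover have "map y [p ?k..p (?k + 1) - 1] = expand_word a s [x ?k]"
    by (simp add: expands_step expands_at expands_at_Suc upto_rec1)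
  moreover have "[i..?k] = [i..?k - 1] @ [?k]" by (simp add: upto_rec2)
  ultimately show ?case using Suc by (simp add: algebra_simps del: expand_word_simps(1,2))
qed simp

end

context
  fixes a s :: 'a and p x y q z w j
  assumes e: "expands a s p x y" and e': "expands a s q z w" and pq: "p j = q j"
begin

text \<open>As \<open>p j = q j\<close>, the cut falls immediately before an original letter and
  never between an \<open>a\<close> and its marker, so the two halves fit together.\<close>

lemma expands_splice: "expands a s (splice_at j p q) (splice_at j x z) (splice_at (p j) y w)"
  unfolding expands_def
proof (intro conjI allI impI)
  fix i
  show "splice_at j p q (i + 1) = splice_at j p q i + (if splice_at j x z i = a then 2 else 1)"
    using expands_step[OF e, of i] expands_step[OF e', of i] pq
    by (cases "i + 1 = j") (auto simp: splice_at_def)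
  show "splice_at (p j) y w (splice_at j p q i) = splice_at j x z i"
    using expands_at[OF e, of i] expands_at[OF e', of i] pq
      expands_less_iff[OF e, of i j] expands_less_iff[OF e', of i j]
    by (auto simp: splice_at_def)
  show "splice_at (p j) y w (splice_at j p q i + 1) = s" if "splice_at j x z i = a"
    using expands_at_Suc[OF e, of i] expands_at_Suc[OF e', of i] pq that
      expands_less[OF e, of i j] expands_less_iff[OF e', of i j]
    by (auto simp: splice_at_def split: if_splits)
qed (use expands_fresh[OF e] expands_fresh[OF e'] in \<open>auto simp: splice_at_def\<close>)

lemma expands_agree_right:
  assumes "\<And>i. i \<ge> j \<Longrightarrow> x i = z i" "l \<ge> p j"
  shows "y l = w l"
proof -
  have eq: "p i = q i" if "i \<ge> j" for i
    using that
  proof (induction i rule: int_ge_induct)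
    case (step i)
    then show ?case using expands_step[OF e, of i] expands_step[OF e', of i] assms(1)[of i] by simp
  qed (rule pq)
  obtain i where i: "i \<ge> j" "l = p i \<or> x i = a \<and> l = p i + 1"
    using expands_cover_right[OF e assms(2)] by blast
  show ?thesis
    using i(2) eq[OF i(1)] assms(1)[OF i(1)] expands_at[OF e, of i] expands_at[OF e', of i]
      expands_at_Suc[OF e, of i] expands_at_Suc[OF e', of i] by auto
qed

lemma expands_agree_left:
  assumes "\<And>i. i < j \<Longrightarrow> x i = z i" "l < p j"
  shows "y l = w l"
proof -
  have eq: "p i = q i" if "i \<le> j" for i
    using that
  proof (induction i rule: int_le_induct)
    case (step i)
    then show ?case
      using expands_step[OF e, of "i - 1"] expands_step[OF e', of "i - 1"] assms(1)[of "i - 1"] by simp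
  qed (rule pq)
  obtain i where i: "i < j" "l = p i \<or> x i = a \<and> l = p i + 1"
    using expands_cover_left[OF e assms(2)] by blast
  show ?thesis
    using i eq[of i] assms(1)[OF i(1)] expands_at[OF e, of i] expands_at[OF e', of i]
      expands_at_Suc[OF e, of i] expands_at_Suc[OF e', of i] by auto
qed

lemma collapse_agree_right:
  assumes "\<And>l. l \<ge> p j \<Longrightarrow> y l = w l" "i \<ge> j"
  shows "x i = z i"
proof -
  have "p i = q i \<and> x i = z i"
    using assms(2)
  proof (induction i rule: int_ge_induct)
    case base
    then show ?case
      using pq assms(1)[of "p j"] expands_at[OF e, of j] expands_at[OF e', of j] by simp
  next
    case (step i)
    then have "p (i + 1) = q (i + 1)"
      using expands_step[OF e, of i] expands_step[OF e', of i] by simp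
    then show ?case
      using assms(1)[of "p (i + 1)"] expands_le[OF e, of j "i + 1"] step(1)
        expands_at[OF e, of "i + 1"] expands_at[OF e', of "i + 1"] by simp
  qed
  then show ?thesis ..
qed

text \<open>Going right, the letter at the current position tells the length of the step. Going
  left, the preceding letter does: the step into \<open>p i\<close> has length 2 exactly if
  \<open>y (p i - 1)\<close> is the marker.\<close>

lemma collapse_agree_left:
  assumes "\<And>l. l < p j \<Longrightarrow> y l = w l" "i < j"
  shows "x i = z i"
proof -
  have eq: "p i = q i" if "i \<le> j" for i
    using that
  proof (induction i rule: int_le_induct)
    case (step i)
    have "p i \<le> p j" using expands_le[OF e step(1)] step(1) by simp
    then have *: "y (p i - 1) = w (p i - 1)" by (intro assms(1)) simp
    have "x (i - 1) = a \<longleftrightarrow> y (p i - 1) = s"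
      using expands_step[OF e, of "i - 1"] expands_at[OF e, of "i - 1"]
        expands_at_Suc[OF e, of "i - 1"] expands_fresh[OF e, of "i - 1"]
      by (auto simp: add.commute split: if_splits)
    moreover have "z (i - 1) = a \<longleftrightarrow> w (q i - 1) = s"
      using expands_step[OF e', of "i - 1"] expands_at[OF e', of "i - 1"]
        expands_at_Suc[OF e', of "i - 1"] expands_fresh[OF e', of "i - 1"]
      by (auto simp: add.commute split: if_splits)
    ultimately show ?case
      using step * expands_step[OF e, of "i - 1"] expands_step[OF e', of "i - 1"] by simp
  qed (rule pq)
  show ?thesis
    using eq[of i] assms(1)[of "p i"] assms(2) expands_less_iff[OF e, of i j]
      expands_at[OF e, of i] expands_at[OF e', of i] by simp
qed

end

text \<open>The freely chosen anchor \<open>p j = l\<close> serves to align two expansions at a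
  common position, as the splicing and agreement lemmas demand.\<close>

lemma expands_exists:
  assumes "s \<notin> range x"
  shows "\<exists>p y. expands a s p x y \<and> p j = l"
proof -
  define c :: "int \<Rightarrow> int" where "c = (\<lambda>i. if x i = a then 2 else 1)"
  \<comment> \<open>At least one of the two sums is empty: this is the signed sum of step lengths
    from \<open>j\<close> to \<open>i\<close>, starting from the value \<open>l\<close>.\<close>
  define p where "p = (\<lambda>i. l + sum c {j..<i} - sum c {i..<j})"
  have step: "p (i + 1) = p i + c i" for i
  proof (cases "i \<ge> j")
    case True
    then have "{j..<i + 1} = insert i {j..<i}" by auto
    then show ?thesis using True by (simp add: p_def)
  next
    case False
    then have "{i..<j} = insert i {i + 1..<j}" by auto
    then show ?thesis using False by (simp add: p_def)
  qed
  have le: "p i + (k - i) \<le> p k" if "i \<le> k" for i k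
    by (rule int_steps_le[OF _ that]) (simp add: step c_def)
  have inj: "inj p"
    by (rule injI) (metis add_le_same_cancel1 antisym diff_ge_0_iff_ge le linorder_le_cases diff_le_0_iff_le)
  define y where "y = (\<lambda>i. if i \<in> range p then x (inv p i) else s)"
  have "p i + 1 \<notin> range p" if "x i = a" for i
  proof
    assume "p i + 1 \<in> range p"
    then obtain k where k: "p i + 1 = p k" by blast
    show False
      using le[of k i] le[of "i + 1" k] step[of i] k that by (cases "k \<le> i") (auto simp: c_def)
  qed
  then have "expands a s p x y"
    unfolding expands_def using assms step inj by (auto simp: y_def c_def)
  moreover have "p j = l" by (simp add: p_def)
  ultimately show ?thesis by blast
qed

text \<open>From a position without marker, \<open>P\<close> enumerates the letter positions to the
  right and \<open>Q\<close> those to the left, each jumping over the markers. Since markers stand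
  exactly behind the letters \<open>a\<close>, neither recursion lands on one.\<close>

lemma collapse_exists:
  assumes as: "a \<noteq> s" and y: "\<And>i. y i = a \<longleftrightarrow> y (i + 1) = s" and l: "y l \<noteq> s"
  shows "\<exists>p x. expands a s p x y \<and> p j = l"
proof -
  define P where "P = rec_nat l (\<lambda>_ k. k + (if y k = a then 2 else (1::int)))"
  define Q where "Q = rec_nat l (\<lambda>_ k. k - (if y (k - 1) = s then 2 else (1::int)))"
  have P: "P 0 = l" "P (Suc n) = P n + (if y (P n) = a then 2 else 1)" for n
    by (simp_all add: P_def)
  have Q: "Q 0 = l" "Q (Suc n) = Q n - (if y (Q n - 1) = s then 2 else 1)" for n
    by (simp_all add: Q_def)
  have Ps: "y (P n) \<noteq> s" for n
    using l as y[of "P (n - 1)"] y[of "P (n - 1) + 1"]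
    by (cases n) (auto simp: P algebra_simps)
  have Qs: "y (Q n) \<noteq> s" for n
  proof (cases n)
    case (Suc k)
    then show ?thesis using as y[of "Q k - 2"] by (auto simp: Q algebra_simps)
  qed (simp add: Q l)
  \<comment> \<open>Read from left to right, the leftward recursion obeys the step rule of
    \<open>P\<close>, so both glue to one position map.\<close>
  have Q': "Q n = Q (Suc n) + (if y (Q (Suc n)) = a then 2 else 1)" for n
    using Qs[of n] y[of "Q n - 2"] y[of "Q n - 1"] by (auto simp: Q algebra_simps)
  define p where "p = (\<lambda>i. if j \<le> i then P (nat (i - j)) else Q (nat (j - i)))"
  have step: "p (i + 1) = p i + (if y (p i) = a then 2 else 1)" for i
  proof (cases "j \<le> i")
    case True
    then have "nat (i + 1 - j) = Suc (nat (i - j))" by simp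
    then show ?thesis using True P(2)[of "nat (i - j)"] by (simp add: p_def)
  next
    case False
    then have "nat (j - i) = Suc (nat (j - (i + 1)))" by simp
    moreover have "p (i + 1) = Q (nat (j - (i + 1)))"
      using False by (cases "i + 1 = j") (auto simp: p_def P Q)
    ultimately show ?thesis using False Q'[of "nat (j - (i + 1))"] by (simp add: p_def)
  qed
  have "y (p i) \<noteq> s" for i by (simp add: p_def Ps Qs)
  then have "expands a s p (\<lambda>i. y (p i)) y"
    unfolding expands_def using step y by auto
  moreover have "p j = l" by (simp add: p_def P)
  ultimately show ?thesis by blast
qed

lemma sublist_map_upto:
  assumes "b \<le> i" "i \<le> j" "j \<le> c"
  shows "sublist (map y [i..j]) (map y [b..c])"
proof -
  have "[b..c] = [b..i - 1] @ [i..j] @ [j + 1..c]"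
    using assms upto_split1[of b i c] upto_split2[of i j c] by simp
  then show ?thesis unfolding sublist_def by (metis map_append)
qed

text \<open>Both implications cut a point and its expansion at matching positions \<open>j\<close>
  and \<open>r j\<close>. An arbitrary past on one side is collapsed or expanded to a past on the
  other side, where the hypothesis exchanges the right-rays, and the result is translated back by
  \<open>expands_splice\<close>. The offset in \<open>leads_to\<close> is recomputed because
  expansion changes distances.\<close>

lemma expands_leads_to_correspondence:
  assumes as: "a \<noteq> s"
    and fresh: "\<And>x. x \<in> X \<Longrightarrow> s \<notin> range x"
    and marked: "\<And>y i. y \<in> Y \<Longrightarrow> y i = a \<longleftrightarrow> y (i + 1) = s"
    and mem: "\<And>p x y. expands a s p x y \<Longrightarrow> x \<in> X \<longleftrightarrow> y \<in> Y"
  shows "leads_to_correspondence X Y (\<lambda>x y. \<exists>p. expands a s p x y)"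
proof (rule leads_to_correspondenceI)
  fix x assume "x \<in> X"
  then show "\<exists>y\<in>Y. \<exists>p. expands a s p x y"
    using expands_exists[of s x a 0 0] fresh mem by blast
next
  fix y assume y: "y \<in> Y"
  \<comment> \<open>If \<open>y 0\<close> is the marker, then \<open>y (-1)\<close> is
    \<open>a\<close>, so one of these two letters is not the marker.\<close>
  obtain l where "y l \<noteq> s" using marked[OF y, of "-1"] as by (metis add.left_inverse)
  then show "\<exists>x\<in>X. \<exists>p. expands a s p x y"
    using collapse_exists[where y = y, OF as marked[OF y], of l 0] mem y by blast
next
  fix x z y w
  assume *: "x \<in> X" "z \<in> X" "y \<in> Y" "w \<in> Y" "\<exists>p. expands a s p x y" "\<exists>q. expands a s q z w"
  then obtain p q where p: "expands a s p x y" and q: "expands a s q z w" by blast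
  show "leads_to X x z = leads_to Y y w"
  proof
    assume lead: "leads_to X x z"
    show "leads_to Y y w"
      unfolding leads_to_def
    proof
      fix n
      \<comment> \<open>Agreement with \<open>z\<close> from letter \<open>i\<close> on becomes
        agreement with \<open>w\<close> from \<open>q i\<close> on, so \<open>q i \<le> n\<close> is
        wanted.\<close>
      define i where "i = min 0 (n - q 0)"
      have i: "q i \<le> n" using expands_le[OF q, of i 0] by (simp add: i_def)
      obtain k u where u: "u \<in> X" "left_equivalent X u (shift_by k x)" "\<And>l. l \<ge> i \<Longrightarrow> u l = z l"
        using lead unfolding leads_to_def by blast
      obtain r v where r: "expands a s r u v" "r i = q i"
        using expands_exists[OF fresh[OF u(1)]] by blast
      have v: "v \<in> Y" using mem[OF r(1)] u(1) by simp
      obtain j where j: "\<And>l. l < j \<Longrightarrow> u l = shift_by k x l" "same_past X j u (shift_by k x)"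
        using u(2) unfolding left_equivalent_def by blast
      \<comment> \<open>This offset places letter \<open>j\<close> of \<open>shift_by k x\<close> at
        position \<open>r j\<close>, where \<open>v\<close> has its letter \<open>j\<close>.\<close>
      define k' where "k' = p (j + k) - r j"
      define t where "t = (\<lambda>i. p (i + k) - k')"
      have t: "expands a s t (shift_by k x) (shift_by k' y)"
        unfolding t_def by (rule expands_shift[OF p])
      have tj: "t j = r j" by (simp add: t_def k'_def)
      have "splice_at (r j) c v \<in> Y \<longleftrightarrow> splice_at (r j) c (shift_by k' y) \<in> Y" for c
      proof -
        \<comment> \<open>Stated for two arbitrary expansions aligned at \<open>r j\<close>, so that
          it can be used in both directions. The letter at the cut is not a marker, hence the
          spliced point can be collapsed with its letter \<open>j\<close> there.\<close>
        have transfer: "splice_at (r j) c v2 \<in> Y"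
          if 1: "expands a s r1 u1 v1" "r1 j = r j" and 2: "expands a s r2 u2 v2" "r2 j = r j"
            and past: "\<And>c. splice_at j c u1 \<in> X \<Longrightarrow> splice_at j c u2 \<in> X"
            and c: "splice_at (r j) c v1 \<in> Y" for r1 u1 v1 r2 u2 v2
        proof -
          have "splice_at (r j) c v1 (r j) = u1 j"
            using expands_at[OF 1(1), of j] 1(2) by (simp add: splice_at_def)
          then have "splice_at (r j) c v1 (r j) \<noteq> s" using expands_fresh[OF 1(1)] by simp
          then obtain g d where g: "expands a s g d (splice_at (r j) c v1)" "g j = r j"
            using collapse_exists[where y = "splice_at (r j) c v1", OF as marked[OF c]] by blast
          have "d l = u1 l" if "l \<ge> j" for l
            by (rule collapse_agree_right[OF g(1) 1(1) _ _ that])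
              (use g(2) 1(2) in \<open>auto simp: splice_at_def\<close>)
          then have "splice_at j d u1 = d" by (auto simp: splice_at_def)
          then have "splice_at j d u2 \<in> X" using past[of d] mem[OF g(1)] c by simp
          moreover have "expands a s (splice_at j g r2) (splice_at j d u2)
              (splice_at (g j) (splice_at (r j) c v1) v2)"
            by (rule expands_splice[OF g(1) 2(1)]) (use g 2 in simp)
          moreover have "splice_at (g j) (splice_at (r j) c v1) v2 = splice_at (r j) c v2"
            using g(2) by (auto simp: splice_at_def)
          ultimately show ?thesis using mem by metis
        qed
        show ?thesis
          using transfer[OF r(1) refl t tj] transfer[OF t tj r(1) refl] j(2)
          unfolding same_past_def by blast
      qed
      then have "same_past Y (r j) v (shift_by k' y)" by (simp add: same_past_def)
      moreover have "v l = shift_by k' y l" if "l < r j" for l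
        by (rule expands_agree_left[OF r(1) t tj[symmetric] j(1) that])
      ultimately have "left_equivalent Y v (shift_by k' y)" unfolding left_equivalent_def by blast
      moreover have "v l = w l" if "l \<ge> n" for l
        by (rule expands_agree_right[OF r(1) q r(2) u(3)]) (use i r(2) that in auto)
      ultimately show "\<exists>k. \<exists>v\<in>Y. left_equivalent Y v (shift_by k y) \<and> (\<forall>l\<ge>n. v l = w l)"
        using v by blast
    qed
  next
    assume lead: "leads_to Y y w"
    show "leads_to X x z"
      unfolding leads_to_def
    proof
      fix n
      obtain k v where v: "v \<in> Y" "left_equivalent Y v (shift_by k y)" "\<And>l. l \<ge> q n \<Longrightarrow> v l = w l"
        using lead unfolding leads_to_def by blast
      have "v (q n) \<noteq> s" using v(3)[of "q n"] expands_at[OF q, of n] expands_fresh[OF q] by simp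
      then obtain r u where r: "expands a s r u v" "r n = q n"
        using collapse_exists[where y = v, OF as marked[OF v(1)]] by blast
      have u: "u \<in> X" using mem[OF r(1)] v(1) by simp
      have uz: "u l = z l" if "l \<ge> n" for l
        by (rule collapse_agree_right[OF r(1) q r(2) _ that]) (use v(3) r(2) in simp)
      obtain j0 where j0: "\<And>l. l < j0 \<Longrightarrow> v l = shift_by k y l" "same_past Y j0 v (shift_by k y)"
        using v(2) unfolding left_equivalent_def by blast
      \<comment> \<open>The given cut \<open>j0\<close> may separate an \<open>a\<close> from its
        marker, so it is moved to a letter position of \<open>v\<close>. It has to lie strictly
        below \<open>j0\<close>, whence the 1: the agreement at \<open>r j\<close> itself shows that
        \<open>shift_by k y\<close> has a letter there as well.\<close>
      define j where "j = min 0 (j0 - 1 - r 0)"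
      have j: "r j < j0" using expands_le[OF r(1), of j 0] by (simp add: j_def)
      have past: "same_past Y (r j) v (shift_by k y)"
        by (rule same_past_mono[OF j0(2,1)]) (use j in simp_all)
      have "y (r j + k) = u j" using j0(1)[OF j] expands_at[OF r(1)] by simp
      then obtain i where i: "r j + k = p i"
        using expands_mem_range[OF p] expands_fresh[OF r(1)] by metis
      define k' where "k' = i - j"
      define t where "t = (\<lambda>i. p (i + k') - k)"
      have t: "expands a s t (shift_by k' x) (shift_by k y)"
        unfolding t_def by (rule expands_shift[OF p])
      have tj: "t j = r j" using i by (simp add: t_def k'_def)
      have "splice_at j c u \<in> X \<longleftrightarrow> splice_at j c (shift_by k' x) \<in> X" for c
      proof -
        have transfer: "splice_at j c u2 \<in> X"
          if 1: "expands a s r1 u1 v1" "r1 j = r j" and 2: "expands a s r2 u2 v2" "r2 j = r j"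
            and past: "\<And>c. splice_at (r j) c v1 \<in> Y \<Longrightarrow> splice_at (r j) c v2 \<in> Y"
            and c: "splice_at j c u1 \<in> X" for r1 u1 v1 r2 u2 v2
        proof -
          obtain g d where g: "expands a s g (splice_at j c u1) d" "g j = r j"
            using expands_exists[OF fresh[OF c]] by blast
          have "d l = v1 l" if "l \<ge> r j" for l
            by (rule expands_agree_right[OF g(1) 1(1), where j = j])
              (use g(2) 1(2) that in \<open>auto simp: splice_at_def\<close>)
          then have "splice_at (r j) d v1 = d" by (auto simp: splice_at_def)
          then have "splice_at (r j) d v2 \<in> Y" using past[of d] mem[OF g(1)] c by simp
          moreover have "expands a s (splice_at j g r2) (splice_at j (splice_at j c u1) u2) (splice_at (g j) d v2)"
            by (rule expands_splice[OF g(1) 2(1)]) (use g 2 in simp)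
          moreover have "splice_at j (splice_at j c u1) u2 = splice_at j c u2" by (auto simp: splice_at_def)
          ultimately show ?thesis using mem g(2) by metis
        qed
        show ?thesis
          using transfer[OF r(1) refl t tj] transfer[OF t tj r(1) refl] past
          unfolding same_past_def by blast
      qed
      then have "same_past X j u (shift_by k' x)" by (simp add: same_past_def)
      moreover have "u l = shift_by k' x l" if "l < j" for l
        by (rule collapse_agree_left[OF r(1) t tj[symmetric] _ that]) (use j0 j in simp)
      ultimately have "left_equivalent X u (shift_by k' x)" unfolding left_equivalent_def by blast
      then show "\<exists>k. \<exists>u\<in>X. left_equivalent X u (shift_by k x) \<and> (\<forall>l\<ge>n. u l = z l)"
        using u uz by blast
    qed
  qed
qed

text \<open>Words of length two in the language of \<open>Y\<close> show that markers stand exactly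
  behind the letters \<open>a\<close>; central words show that membership passes between a point and
  its expansion.\<close>

lemma symbol_expansion_imp_leads_to_equiv:
  assumes "symbol_expansion A X B Y"
  shows "leads_to_equiv X Y"
proof -
  obtain a s where X: "shift_space A X" and Y: "shift_space B Y" and a: "a \<in> A" and s: "s \<notin> A"
    and lang: "language Y = {u. \<exists>w\<in>language X. sublist u (expand_word a s w)}"
    using assms unfolding symbol_expansion_def by blast
  have as: "a \<noteq> s" using a s by blast
  have "X \<subseteq> {x. range x \<subseteq> A}"
    using X closedin_subset by (metis shift_space_def topspace_full_shift)
  then have fresh: "s \<notin> range x" if "x \<in> X" for x using s that by blast
  have fresh_word: "s \<notin> set w" if "w \<in> language X" for w
    using that fresh by (fastforce simp: language_def occurs_in_def)
  have marked: "y i = a \<longleftrightarrow> y (i + 1) = s" if y: "y \<in> Y" for y i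
  proof -
    have "[y i, y (i + 1)] \<in> language Y"
      using map_upto_language[OF y, of i "i + 1"] by (simp add: upto_rec1)
    then obtain w ps ss where w: "w \<in> language X"
      "expand_word a s w = ps @ [y i, y (i + 1)] @ ss"
      by (auto simp: lang sublist_def)
    have "Suc (length ps) < length (expand_word a s w)" by (simp add: w(2))
    then have "expand_word a s w ! length ps = a \<longleftrightarrow> expand_word a s w ! Suc (length ps) = s"
      using expand_word_nth[OF as fresh_word[OF w(1)]] by blast
    then show ?thesis by (simp add: w(2) nth_append)
  qed
  have mem: "x \<in> X \<longleftrightarrow> y \<in> Y" if e: "expands a s p x y" for p x y
  proof
    assume x: "x \<in> X"
    have "map y [-n..n] \<in> language Y" if "n \<ge> 0" for n
    proof -
      \<comment> \<open>The letters from \<open>i\<close> to \<open>i + int N - 1\<close> are chosen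
        so that their expansion covers the positions from \<open>-n\<close> to
        \<open>n\<close>.\<close>
      define i where "i = min 0 (- n - p 0)"
      define N where "N = nat (n + 1 - p i)"
      have i: "p i \<le> - n" using expands_le[OF e, of i 0] by (simp add: i_def)
      have "N = n + 1 - p i" using i that by (simp add: N_def)
      then have N: "n \<le> p (i + int N) - 1" using expands_le[OF e, of i "i + int N"] by simp
      have "sublist (map y [-n..n]) (expand_word a s (map x [i..i + int N - 1]))"
        unfolding expands_word[OF e, symmetric] by (rule sublist_map_upto) (use i N that in auto)
      then show ?thesis unfolding lang using map_upto_language[OF x] by blast
    qed
    then show "y \<in> Y" using shift_space_mem_iff_language[OF Y] by blast
  next
    assume y: "y \<in> Y"
    have "map x [-n..n] \<in> language X" if "n \<ge> 0" for n
    proof -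
      define u where "u = map x [-n..n]"
      have su: "s \<notin> set u" using expands_fresh[OF e] by (auto simp: u_def)
      have "expand_word a s u = map y [p (-n)..p (n + 1) - 1]"
        using expands_word[OF e, of "-n" "nat (2 * n + 1)"] that
        by (simp add: u_def algebra_simps)
      then have "expand_word a s u \<in> language Y" using map_upto_language[OF y] by simp
      then obtain w ps ss where w: "w \<in> language X" "expand_word a s w = ps @ expand_word a s u @ ss"
        by (auto simp: lang sublist_def)
      \<comment> \<open>Deleting markers commutes with concatenation, so \<open>u\<close> reappears
        as a block of \<open>w\<close>, even if the surrounding pieces cut an \<open>a\<close> from
        its marker.\<close>
      have "w = filter (\<lambda>c. c \<noteq> s) ps @ u @ filter (\<lambda>c. c \<noteq> s) ss"
        using arg_cong[OF w(2), of "filter (\<lambda>c. c \<noteq> s)"]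
          filter_expand_word[OF as fresh_word[OF w(1)]] filter_expand_word[OF as su] by simp
      then show ?thesis using sublist_language[OF w(1)] by (auto simp: u_def sublist_def)
    qed
    then show "x \<in> X" using shift_space_mem_iff_language[OF X] by blast
  qed
  show ?thesis
    by (rule leads_to_equivI[OF expands_leads_to_correspondence[OF as fresh marked mem]])
qed

section \<open>The left Krieger cover\<close>

definition vertex_at :: "(int \<Rightarrow> 'a) set \<Rightarrow> int \<Rightarrow> (int \<Rightarrow> 'a) \<Rightarrow> (nat \<Rightarrow> 'a) set" where
  "vertex_at X i x = predecessor_set X (right_ray (shift_by i x))"

lemma vertex_at_shift_by [simp]: "vertex_at X i (shift_by k x) = vertex_at X (i + k) x"
  by (simp add: vertex_at_def)

lemma vertex_at_cong:
  assumes "\<And>l. l \<ge> i \<Longrightarrow> x l = z l"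
  shows "vertex_at X i x = vertex_at X i z"
  using assms by (simp add: vertex_at_def right_ray_def)

text \<open>The left-ray of the glued point is \<open>l\<close> itself. The index
  \<open>i - 1 - n\<close> turns the right-to-left numbering of \<open>l\<close> back into
  coordinates left of \<open>i\<close>.\<close>

lemma mem_vertex_at_iff:
  assumes "shift_map ` X = X"
  shows "l \<in> vertex_at X i x \<longleftrightarrow> splice_at i (\<lambda>n. l (nat (i - 1 - n))) x \<in> X"
proof -
  let ?g = "glue l (right_ray (shift_by i x))"
  have "left_ray ?g = l" by (auto simp: left_ray_def glue_def)
  then have "l \<in> vertex_at X i x \<longleftrightarrow> ?g \<in> X"
    unfolding vertex_at_def predecessor_set_def by (metis (mono_tags, lifting) image_eqI mem_Collect_eq)
  moreover have "?g = shift_by i (splice_at i (\<lambda>n. l (nat (i - 1 - n))) x)"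
    by (auto simp: glue_def splice_at_def right_ray_def fun_eq_iff algebra_simps)
  ultimately show ?thesis using shift_by_mem_iff[OF assms] by metis
qed

lemma vertex_at_eq_iff:
  fixes X :: "(int \<Rightarrow> 'a) set"
  assumes "shift_map ` X = X"
  shows "vertex_at X i x = vertex_at X i z \<longleftrightarrow> same_past X i x z"
proof
  assume eq: "vertex_at X i x = vertex_at X i z"
  show "same_past X i x z"
    unfolding same_past_def
  proof
    fix w :: "int \<Rightarrow> 'a"
    define l where "l = (\<lambda>n. w (i - 1 - int n))"
    have "splice_at i w x = splice_at i (\<lambda>n. l (nat (i - 1 - n))) x"
      and "splice_at i w z = splice_at i (\<lambda>n. l (nat (i - 1 - n))) z"
      by (auto simp: splice_at_def l_def)
    then show "splice_at i w x \<in> X \<longleftrightarrow> splice_at i w z \<in> X"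
      using eq mem_vertex_at_iff[OF assms, of l i] by metis
  qed
next
  assume "same_past X i x z"
  then show "vertex_at X i x = vertex_at X i z"
    using mem_vertex_at_iff[OF assms] unfolding same_past_def by blast
qed

lemma verts_left_krieger_cover: "verts (left_krieger_cover X) = vertex_at X 0 ` X"
  by (auto simp: left_krieger_cover_def vertex_at_def)

lemma vertex_at_in_verts:
  assumes "shift_map ` X = X" "x \<in> X"
  shows "vertex_at X i x \<in> verts (left_krieger_cover X)"
proof -
  have "vertex_at X i x = vertex_at X 0 (shift_by i x)" by simp
  then show ?thesis
    using shift_by_mem[OF assms] unfolding verts_left_krieger_cover by blast
qed

lemma wf_left_krieger_cover: "wf_digraph (left_krieger_cover X)"
  by standard (auto simp: left_krieger_cover_def)

text \<open>The source of an edge labelled \<open>b\<close> equals the vertex of the ray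
  \<open>case_nat b r\<close>, which belongs to a point of \<open>X\<close>. So every edge is one
  step along some point.\<close>

lemma left_krieger_cover_dominates_iff:
  assumes "shift_map ` X = X"
  shows "v \<rightarrow>\<^bsub>left_krieger_cover X\<^esub> w \<longleftrightarrow> (\<exists>x\<in>X. v = vertex_at X 0 x \<and> w = vertex_at X 1 x)"
proof
  assume "v \<rightarrow>\<^bsub>left_krieger_cover X\<^esub> w"
  then obtain b r where v: "v = predecessor_set X (case_nat b r)" and w: "w = predecessor_set X r"
    and br: "case_nat b r \<in> right_ray ` X"
    by (auto simp: arcs_ends_conv left_krieger_cover_def)
  obtain x where x: "x \<in> X" "case_nat b r = right_ray x" using br by blast
  have "r n = right_ray (shift_by 1 x) n" for n
    using fun_cong[OF x(2), of "Suc n"] by (simp add: right_ray_def algebra_simps)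
  then have "r = right_ray (shift_by 1 x)" by blast
  then have "v = vertex_at X 0 x" "w = vertex_at X 1 x"
    using v w x(2) by (simp_all add: vertex_at_def)
  then show "\<exists>x\<in>X. v = vertex_at X 0 x \<and> w = vertex_at X 1 x" using x(1) by blast
next
  assume "\<exists>x\<in>X. v = vertex_at X 0 x \<and> w = vertex_at X 1 x"
  then obtain x where x: "x \<in> X" "v = vertex_at X 0 x" "w = vertex_at X 1 x" by blast
  let ?r = "right_ray (shift_by 1 x)"
  have q: "case_nat (x 0) ?r = right_ray x"
    by (auto simp: right_ray_def fun_eq_iff algebra_simps split: nat.split)
  have "(predecessor_set X (right_ray x), x 0, predecessor_set X ?r) \<in> arcs (left_krieger_cover X)"
    using x(1) q shift_by_mem[OF assms x(1), of 1] unfolding left_krieger_cover_def by force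
  then show "v \<rightarrow>\<^bsub>left_krieger_cover X\<^esub> w"
    unfolding x(2,3) vertex_at_def arcs_ends_conv
    by (intro image_eqI) (auto simp: left_krieger_cover_def)
qed

lemma vertex_at_reachable1:
  assumes X: "shift_map ` X = X" and x: "x \<in> X" and "i < j"
  shows "vertex_at X i x \<rightarrow>\<^sup>+\<^bsub>left_krieger_cover X\<^esub> vertex_at X j x"
proof -
  have edge: "vertex_at X k x \<rightarrow>\<^bsub>left_krieger_cover X\<^esub> vertex_at X (k + 1) x" for k
    unfolding left_krieger_cover_dominates_iff[OF X]
    by (rule bexI[of _ "shift_by k x"]) (auto simp: shift_by_mem[OF X x] add.commute)
  show ?thesis
    using \<open>i < j\<close>
  proof (induction j rule: int_gr_induct)
    case base
    show ?case using edge by (rule r_into_trancl)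
  next
    case (step k)
    show ?case using step(2) edge by (rule trancl_into_trancl)
  qed
qed

text \<open>An edge into the vertex of \<open>t\<close> at \<open>i\<close> is realised by some
  point \<open>y\<close>. As \<open>y\<close> and \<open>t\<close> have the same past at
  \<open>i\<close>, the right-ray of \<open>y\<close> there may be replaced by that of
  \<open>t\<close>, and this leaves the vertex at \<open>i - 1\<close> unchanged. Repeating this
  backwards along the path keeps \<open>z\<close> from \<open>j\<close> on.\<close>

lemma reachable1_lift:
  assumes X: "shift_map ` X = X" and z: "z \<in> X"
    and "v \<rightarrow>\<^sup>+\<^bsub>left_krieger_cover X\<^esub> vertex_at X j z"
  shows "\<exists>u\<in>X. \<exists>i<j. vertex_at X i u = v \<and> (\<forall>l\<ge>j. u l = z l)"
proof -
  have lift: "\<exists>u\<in>X. vertex_at X (i - 1) u = v \<and> (\<forall>l\<ge>i. u l = t l)"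
    if dom: "v \<rightarrow>\<^bsub>left_krieger_cover X\<^esub> vertex_at X i t" and t: "t \<in> X" for v i t
  proof -
    obtain x where x: "x \<in> X" "v = vertex_at X 0 x" "vertex_at X i t = vertex_at X 1 x"
      using dom unfolding left_krieger_cover_dominates_iff[OF X] by blast
    define y where "y = shift_by (1 - i) x"
    have y: "y \<in> X" "vertex_at X (i - 1) y = v" "vertex_at X i y = vertex_at X i t"
      using x shift_by_mem[OF X x(1)] by (simp_all add: y_def)
    then have past: "same_past X i y t" using vertex_at_eq_iff[OF X] by blast
    define u where "u = splice_at i y t"
    have "splice_at i y y = y" by (simp add: splice_at_def)
    then have u: "u \<in> X" using past y(1) unfolding same_past_def u_def by metis
    have "splice_at i w u = splice_at i w t" for w by (auto simp: splice_at_def u_def)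
    then have "same_past X i y u" using past by (simp add: same_past_def)
    then have "same_past X (i - 1) y u"
      by (rule same_past_mono) (auto simp: u_def splice_at_def)
    then have "vertex_at X (i - 1) u = v" using vertex_at_eq_iff[OF X] y(2) by blast
    moreover have "\<forall>l\<ge>i. u l = t l" by (simp add: u_def splice_at_def)
    ultimately show ?thesis using u by blast
  qed
  show ?thesis
    using assms(3)
  proof (induction v rule: converse_trancl_induct)
    case (base v)
    obtain u where "u \<in> X" "vertex_at X (j - 1) u = v" "\<forall>l\<ge>j. u l = z l"
      using lift[OF base z] by blast
    then show ?case by (intro bexI[of _ u] exI[of _ "j - 1"]) simp_all
  next
    case (step v v')
    then obtain u i where u: "u \<in> X" "i < j" "vertex_at X i u = v'" "\<forall>l\<ge>j. u l = z l" by blast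
    obtain t where t: "t \<in> X" "vertex_at X (i - 1) t = v" "\<forall>l\<ge>i. t l = u l"
      using lift[of v i u] step(1) u by blast
    have "i - 1 < j" "\<forall>l\<ge>j. t l = z l" using t(3) u(2,4) by auto
    then show ?case using t(1,2) by blast
  qed
qed

section \<open>Proper communication sets and reachability between them\<close>

lemma properly_communicate_sym: "properly_communicate E v w \<Longrightarrow> properly_communicate E w v"
  by (auto simp: properly_communicate_def)

lemma properly_communicate_trans:
  "properly_communicate E u v \<Longrightarrow> properly_communicate E v w \<Longrightarrow> properly_communicate E u w"
  unfolding properly_communicate_def by (meson trancl_trans)

lemma proper_communication_set_eqI:
  assumes C: "proper_communication_set E C" and D: "proper_communication_set E D"
    and v: "v \<in> C" and w: "w \<in> D" and vw: "properly_communicate E v w"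
  shows "C = D"
proof -
  have sub: "C \<union> D \<subseteq> verts E" using C D by (auto simp: proper_communication_set_def)
  have CC: "\<And>p q. p \<in> C \<Longrightarrow> q \<in> C \<Longrightarrow> properly_communicate E p q"
    and DD: "\<And>p q. p \<in> D \<Longrightarrow> q \<in> D \<Longrightarrow> properly_communicate E p q"
    using C D by (auto simp: proper_communication_set_def)
  have CD: "properly_communicate E p q" if "p \<in> C" "q \<in> D" for p q
    using CC[OF that(1) v] vw DD[OF w that(2)] properly_communicate_trans by metis
  have all: "\<forall>p\<in>C \<union> D. \<forall>q\<in>C \<union> D. properly_communicate E p q"
    using CC DD CD CD[THEN properly_communicate_sym] by blast
  have "C \<union> D = C" using C sub all unfolding proper_communication_set_def by blast
  moreover have "C \<union> D = D" using D sub all unfolding proper_communication_set_def by blast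
  ultimately show ?thesis by simp
qed

text \<open>The arcs of the proper communication graph are this relation off the diagonal. With the
  diagonal it is a partial order on the proper communication sets, the form in which
  \<open>leads_to\<close> describes it.\<close>

definition set_reaches :: "('v, 'e) pre_digraph \<Rightarrow> 'v set \<Rightarrow> 'v set \<Rightarrow> bool" where
  "set_reaches E C D \<longleftrightarrow> (\<exists>v\<in>C. \<exists>w\<in>D. v \<rightarrow>\<^sup>*\<^bsub>E\<^esub> w)"

lemma set_reaches_refl: "proper_communication_set E C \<Longrightarrow> set_reaches E C C"
  unfolding proper_communication_set_def set_reaches_def reachable_def
  by (metis ex_in_conv rtrancl_on_refl subsetD)

lemma set_reaches_reachable1:
  assumes E: "wf_digraph E" and C: "proper_communication_set E C" and D: "proper_communication_set E D"
    and CD: "set_reaches E C D" and v: "v \<in> C" and w: "w \<in> D"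
  shows "v \<rightarrow>\<^sup>+\<^bsub>E\<^esub> w"
proof -
  obtain v' w' where *: "v' \<in> C" "w' \<in> D" "v' \<rightarrow>\<^sup>*\<^bsub>E\<^esub> w'" using CD by (auto simp: set_reaches_def)
  have "v \<rightarrow>\<^sup>+\<^bsub>E\<^esub> v'" "w' \<rightarrow>\<^sup>+\<^bsub>E\<^esub> w"
    using C D v w * by (auto simp: proper_communication_set_def properly_communicate_def)
  moreover have "v' = w' \<or> v' \<rightarrow>\<^sup>+\<^bsub>E\<^esub> w'"
    using wf_digraph.reachable_neq_reachable1[OF E *(3)] by blast
  ultimately show ?thesis by (metis trancl_trans)
qed

lemma set_reaches_antisym:
  assumes "wf_digraph E" "proper_communication_set E C" "proper_communication_set E D"
    and "set_reaches E C D" "set_reaches E D C"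
  shows "C = D"
proof -
  obtain v w where vw: "v \<in> C" "w \<in> D" using assms(4) by (auto simp: set_reaches_def)
  then have "properly_communicate E v w"
    using set_reaches_reachable1[OF assms(1,2,3,4)] set_reaches_reachable1[OF assms(1,3,2,5)]
    by (simp add: properly_communicate_def)
  then show ?thesis using proper_communication_set_eqI[OF assms(2,3) vw] by simp
qed

text \<open>The vertices through which the path of \<open>x\<close> in the Krieger cover passes far to the left
  form, together with those communicating with them, one proper communication set.\<close>

definition limit_set :: "(int \<Rightarrow> 'a) set \<Rightarrow> (int \<Rightarrow> 'a) \<Rightarrow> (nat \<Rightarrow> 'a) set set" where
  "limit_set X x =
     {w. \<exists>N. \<forall>i\<le>N. properly_communicate (left_krieger_cover X) w (vertex_at X i x)}"

section \<open>Limit sets when the cover is finite\<close>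

context
  fixes A :: "'a set" and X :: "(int \<Rightarrow> 'a) set"
  assumes shift: "shift_space A X" and fin: "finite (verts (left_krieger_cover X))"
begin

private lemma shift_invariant: "shift_map ` X = X"
  using shift by (simp add: shift_space_def)

text \<open>\<open>F\<close> collects the vertices that the path avoids from some coordinate
  leftwards, and finiteness gives one bound \<open>N\<close> for all of them. A vertex met at or
  left of \<open>N\<close> recurs arbitrarily far to the left, hence reaches every vertex of the
  path.\<close>

lemma vertex_at_eventually_communicate:
  assumes x: "x \<in> X"
  shows "\<exists>N. \<forall>i\<le>N. \<forall>j\<le>N. properly_communicate (left_krieger_cover X) (vertex_at X i x) (vertex_at X j x)"
proof -
  define F where "F = {v \<in> verts (left_krieger_cover X). \<exists>N. \<forall>i\<le>N. vertex_at X i x \<noteq> v}"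
  have finF: "finite F" using fin by (simp add: F_def)
  have "\<forall>v\<in>F. \<exists>N. \<forall>i\<le>N. vertex_at X i x \<noteq> v" by (simp add: F_def)
  then obtain M where M: "\<forall>v\<in>F. \<forall>i\<le>M v. vertex_at X i x \<noteq> v" by metis
  define N where "N = Min (insert 0 (M ` F))"
  have notF: "vertex_at X i x \<notin> F" if "i \<le> N" for i
  proof
    assume F: "vertex_at X i x \<in> F"
    then have "N \<le> M (vertex_at X i x)" using finF by (simp add: N_def)
    then have "i \<le> M (vertex_at X i x)" using that by simp
    then show False using M F by blast
  qed
  have reach: "vertex_at X i x \<rightarrow>\<^sup>+\<^bsub>left_krieger_cover X\<^esub> vertex_at X j x" if iN: "i \<le> N" for i j
  proof -
    obtain k where "k \<le> j - 1" "vertex_at X k x = vertex_at X i x"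
      using notF[OF iN] vertex_at_in_verts[OF shift_invariant x] unfolding F_def by blast
    then show ?thesis using vertex_at_reachable1[OF shift_invariant x, of k j] by simp
  qed
  then show ?thesis unfolding properly_communicate_def by blast
qed

lemma vertex_at_eventually_in_limit_set:
  assumes x: "x \<in> X"
  shows "\<exists>N. \<forall>i\<le>N. vertex_at X i x \<in> limit_set X x"
  using vertex_at_eventually_communicate[OF x] unfolding limit_set_def by blast

lemma proper_communication_set_limit_set:
  assumes x: "x \<in> X"
  shows "proper_communication_set (left_krieger_cover X) (limit_set X x)"
  unfolding proper_communication_set_def
proof (intro conjI ballI allI impI)
  let ?E = "left_krieger_cover X"
  obtain N where N: "\<And>i. i \<le> N \<Longrightarrow> vertex_at X i x \<in> limit_set X x"
    using vertex_at_eventually_in_limit_set[OF x] by blast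
  show "limit_set X x \<noteq> {}" using N by blast
  show "limit_set X x \<subseteq> verts ?E"
    unfolding limit_set_def properly_communicate_def
    using wf_digraph.reachable1_in_verts(1)[OF wf_left_krieger_cover] by blast
  show comm: "properly_communicate ?E v w" if vw: "v \<in> limit_set X x" "w \<in> limit_set X x" for v w
  proof -
    obtain N1 N2 where "\<forall>i\<le>N1. properly_communicate ?E v (vertex_at X i x)"
      "\<forall>i\<le>N2. properly_communicate ?E w (vertex_at X i x)"
      using vw unfolding limit_set_def by blast
    then have "properly_communicate ?E v (vertex_at X (min N1 N2) x)"
      "properly_communicate ?E w (vertex_at X (min N1 N2) x)" by simp_all
    then show ?thesis using properly_communicate_trans properly_communicate_sym by metis
  qed
  fix D assume D: "limit_set X x \<subseteq> D \<and> D \<subseteq> verts ?E \<and> (\<forall>v\<in>D. \<forall>w\<in>D. properly_communicate ?E v w)"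
  have "v \<in> limit_set X x" if "v \<in> D" for v
  proof -
    have "properly_communicate ?E v (vertex_at X i x)" if "i \<le> N" for i
      using D \<open>v \<in> D\<close> N[OF that] by blast
    then show ?thesis unfolding limit_set_def by blast
  qed
  then show "D = limit_set X x" using D by blast
qed

text \<open>A vertex \<open>v\<close> in \<open>C\<close> lies on a cycle. Lifting the cycle
  backwards again and again yields points that stabilise from the right and pass through
  \<open>v\<close> further and further to the left; closedness puts their limit in
  \<open>X\<close>.\<close>

lemma limit_set_surj:
  assumes C: "proper_communication_set (left_krieger_cover X) C"
  shows "\<exists>x\<in>X. limit_set X x = C"
proof -
  let ?E = "left_krieger_cover X"
  obtain v where v: "v \<in> C" using C by (auto simp: proper_communication_set_def)
  have vv: "v \<rightarrow>\<^sup>+\<^bsub>?E\<^esub> v" and "v \<in> verts ?E"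
    using C v by (auto simp: proper_communication_set_def properly_communicate_def)
  then obtain z0 where z0: "z0 \<in> X" "vertex_at X 0 z0 = v"
    unfolding verts_left_krieger_cover by blast
  have "\<exists>f. \<forall>n. (fst (f n) \<in> X \<and> vertex_at X (snd (f n)) (fst (f n)) = v) \<and>
    (snd (f (Suc n)) < snd (f n) \<and> (\<forall>l\<ge>snd (f n). fst (f (Suc n)) l = fst (f n) l))"
  proof (rule dependent_nat_choice)
    show "\<exists>p. fst p \<in> X \<and> vertex_at X (snd p) (fst p) = v"
      using z0 by (intro exI[of _ "(z0, 0)"]) simp
    fix p :: "(int \<Rightarrow> 'a) \<times> int" assume p: "fst p \<in> X \<and> vertex_at X (snd p) (fst p) = v"
    then obtain u i where "u \<in> X" "i < snd p" "vertex_at X i u = v" "\<forall>l\<ge>snd p. u l = fst p l"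
      using reachable1_lift[OF shift_invariant, of "fst p" v "snd p"] vv by auto
    then show "\<exists>q. (fst q \<in> X \<and> vertex_at X (snd q) (fst q) = v) \<and>
        snd q < snd p \<and> (\<forall>l\<ge>snd p. fst q l = fst p l)"
      by (intro exI[of _ "(u, i)"]) simp
  qed
  then obtain f where f: "\<And>n. fst (f n) \<in> X" "\<And>n. vertex_at X (snd (f n)) (fst (f n)) = v"
    "\<And>n. snd (f (Suc n)) < snd (f n)" "\<And>n l. l \<ge> snd (f n) \<Longrightarrow> fst (f (Suc n)) l = fst (f n) l"
    by auto
  define Z where "Z = (\<lambda>n. fst (f n))"
  define I where "I = (\<lambda>n. snd (f n))"
  have I: "I n \<le> I 0 - int n" for n
  proof (induction n)
    case (Suc n)
    then show ?case using f(3)[of n] by (simp add: I_def)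
  qed simp
  have I_anti: "I m \<le> I n" if "n \<le> m" for m n
    using that by (induction m rule: dec_induct) (use f(3) in \<open>auto simp: I_def intro: order_trans less_imp_le\<close>)
  have Z: "Z m l = Z n l" if "n \<le> m" "I n \<le> l" for m n l
    using that(1)
  proof (induction m rule: dec_induct)
    case (step m)
    have "I m \<le> l" using I_anti[OF step(1)] that(2) by simp
    then show ?case using f(4)[of m l] step by (simp add: Z_def I_def)
  qed simp
  \<comment> \<open>The positions \<open>I n\<close> drop by at least 1 each time, so after
    \<open>nat (I 0 - l)\<close> rounds coordinate \<open>l\<close> no longer changes.\<close>
  define x where "x = (\<lambda>l. Z (nat (I 0 - l)) l)"
  have xZ: "x l = Z n l" if "I n \<le> l" for n l
  proof -
    have "I (nat (I 0 - l)) \<le> l" using I[of "nat (I 0 - l)"] I[of 0] by (cases "l \<le> I 0") auto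
    then show ?thesis
      unfolding x_def using Z that by (metis linorder_le_cases)
  qed
  have x: "x \<in> X"
  proof (rule closedin_full_shift_mem)
    show "closedin (full_shift_topology A) X" using shift by (simp add: shift_space_def)
    fix n
    have "Z (nat (I 0 + n)) i = x i" if "\<bar>i\<bar> \<le> n" for i
    proof -
      have "I (nat (I 0 + n)) \<le> - n"
        using I[of "nat (I 0 + n)"] I_anti[of 0 "nat (I 0 + n)"] that by (cases "0 \<le> I 0 + n") auto
      then show ?thesis using xZ[of "nat (I 0 + n)" i] that by simp
    qed
    then show "\<exists>z\<in>X. \<forall>i. \<bar>i\<bar> \<le> n \<longrightarrow> z i = x i" using f(1) unfolding Z_def by blast
  qed
  have xv: "vertex_at X (I n) x = v" for n
    using vertex_at_cong[of "I n" x "Z n" X] xZ f(2)[of n] by (simp add: Z_def I_def)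
  obtain N where N: "\<And>i. i \<le> N \<Longrightarrow> vertex_at X i x \<in> limit_set X x"
    using vertex_at_eventually_in_limit_set[OF x] by blast
  have "I (nat (I 0 - N)) \<le> N" using I[of "nat (I 0 - N)"] I_anti[of 0] by (cases "N \<le> I 0") auto
  then have "v \<in> limit_set X x" using N xv by metis
  then have "limit_set X x = C"
    using proper_communication_set_eqI[OF proper_communication_set_limit_set[OF x] C _ v] vv
    by (simp add: properly_communicate_def)
  then show ?thesis using x by blast
qed

text \<open>A witness \<open>u\<close> of \<open>leads_to\<close> follows, from left to right, a
  path from the limit set of \<open>x\<close> to that of \<open>z\<close>. Conversely, such a path
  lifts to a point ending in \<open>z\<close>, and its left part can be exchanged for that of a
  shift of \<open>x\<close>.\<close>

lemma leads_to_iff_set_reaches: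
  assumes x: "x \<in> X" and z: "z \<in> X"
  shows "leads_to X x z \<longleftrightarrow> set_reaches (left_krieger_cover X) (limit_set X x) (limit_set X z)"
proof
  let ?E = "left_krieger_cover X"
  obtain M where M: "\<And>i. i \<le> M \<Longrightarrow> vertex_at X i x \<in> limit_set X x"
    using vertex_at_eventually_in_limit_set[OF x] by blast
  obtain N where N: "\<And>i. i \<le> N \<Longrightarrow> vertex_at X i z \<in> limit_set X z"
    using vertex_at_eventually_in_limit_set[OF z] by blast
  {
    assume "leads_to X x z"
    then obtain k u where u: "u \<in> X" "left_equivalent X u (shift_by k x)" "\<forall>i\<ge>N. u i = z i"
      unfolding leads_to_def by blast
    \<comment> \<open>\<open>N - 1\<close> makes the path from \<open>j\<close> to \<open>N\<close>
      nonempty, and \<open>M - k\<close> puts the vertex of the shifted \<open>x\<close> at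
      \<open>j\<close> into its limit set.\<close>
    obtain j where j: "j \<le> min (N - 1) (M - k)" "same_past X j u (shift_by k x)"
      by (rule left_equivalentE[OF u(2)])
    have "vertex_at X j u = vertex_at X j (shift_by k x)"
      using j(2) vertex_at_eq_iff[OF shift_invariant] by blast
    then have "vertex_at X j u \<in> limit_set X x" using M[of "j + k"] j(1) by simp
    moreover have "vertex_at X N u \<in> limit_set X z"
      using N[of N] vertex_at_cong[of N u z X] u(3) by simp
    moreover have "vertex_at X j u \<rightarrow>\<^sup>*\<^bsub>?E\<^esub> vertex_at X N u"
      by (rule wf_digraph.reachable1_reachable[OF wf_left_krieger_cover vertex_at_reachable1[OF shift_invariant u(1)]])
        (use j(1) in simp)
    ultimately show "set_reaches ?E (limit_set X x) (limit_set X z)"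
      unfolding set_reaches_def by blast
  next
    assume reach: "set_reaches ?E (limit_set X x) (limit_set X z)"
    show "leads_to X x z"
      unfolding leads_to_def
    proof
      fix n
      define j where "j = min n N"
      have "vertex_at X M x \<rightarrow>\<^sup>+\<^bsub>?E\<^esub> vertex_at X j z"
        by (rule set_reaches_reachable1[OF wf_left_krieger_cover proper_communication_set_limit_set[OF x]
              proper_communication_set_limit_set[OF z] reach M N]) (simp_all add: j_def)
      then obtain u i where u: "u \<in> X" "i < j" "vertex_at X i u = vertex_at X M x" "\<forall>l\<ge>j. u l = z l"
        using reachable1_lift[OF shift_invariant z] by blast
      \<comment> \<open>This shift moves the vertex of \<open>x\<close> at \<open>M\<close> to
        coordinate \<open>i\<close>, where the lifted path begins.\<close>
      define y where "y = shift_by (M - i) x"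
      have y: "y \<in> X" "vertex_at X i y = vertex_at X M x"
        using shift_by_mem[OF shift_invariant x] by (simp_all add: y_def)
      then have past: "same_past X i u y" using u(3) vertex_at_eq_iff[OF shift_invariant] by metis
      define t where "t = splice_at i y u"
      have "splice_at i y y = y" by (simp add: splice_at_def)
      then have "t \<in> X" using past y(1) unfolding same_past_def t_def by metis
      moreover have "splice_at i w t = splice_at i w u" for w by (auto simp: splice_at_def t_def)
      then have "left_equivalent X t y"
        unfolding left_equivalent_def using past
        by (intro exI[of _ i]) (auto simp: same_past_def t_def splice_at_def)
      moreover have "\<forall>l\<ge>n. t l = z l" using u(2,4) by (simp add: t_def splice_at_def j_def)
      ultimately show "\<exists>k. \<exists>u\<in>X. left_equivalent X u (shift_by k x) \<and> (\<forall>i\<ge>n. u i = z i)"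
        unfolding y_def by blast
    qed
  }
qed

end

text \<open>A proper communication set is represented by a point, passed through \<open>R\<close>,
  and mapped to the limit set of the partner. \<open>h\<close> preserves and reflects
  \<open>set_reaches\<close>, so antisymmetry makes it injective; antisymmetry in \<open>Y\<close>
  also shows that it hits every set.\<close>

lemma digraph_iso_proper_communication_graph:
  assumes X: "shift_space A X" "finite (verts (left_krieger_cover X))"
    and Y: "shift_space B Y" "finite (verts (left_krieger_cover Y))"
    and XY: "leads_to_equiv X Y"
  shows "digraph_iso (proper_communication_graph (left_krieger_cover X))
                     (proper_communication_graph (left_krieger_cover Y))"
proof -
  let ?E = "left_krieger_cover X" and ?F = "left_krieger_cover Y"
  let ?G = "proper_communication_graph ?E" and ?H = "proper_communication_graph ?F"
  obtain R where R: "leads_to_correspondence X Y R" using XY unfolding leads_to_equiv_def ..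
  have "\<exists>x y. x \<in> X \<and> limit_set X x = C \<and> y \<in> Y \<and> R x y" if "proper_communication_set ?E C" for C
    using limit_set_surj[OF X that] leads_to_correspondenceD(1)[OF R] by blast
  then obtain \<xi> \<eta> where \<xi>: "\<And>C. proper_communication_set ?E C \<Longrightarrow>
      \<xi> C \<in> X \<and> limit_set X (\<xi> C) = C \<and> \<eta> C \<in> Y \<and> R (\<xi> C) (\<eta> C)"
    by metis
  define h where "h = (\<lambda>C. limit_set Y (\<eta> C))"
  have hP: "proper_communication_set ?F (h C)" if "proper_communication_set ?E C" for C
    using proper_communication_set_limit_set[OF Y] \<xi>[OF that] by (simp add: h_def)
  have h_iff: "set_reaches ?F (h C) (h D) \<longleftrightarrow> set_reaches ?E C D"
    if C: "proper_communication_set ?E C" and D: "proper_communication_set ?E D" for C D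
  proof -
    have "leads_to X (\<xi> C) (\<xi> D) = leads_to Y (\<eta> C) (\<eta> D)"
      using leads_to_correspondenceD(3)[OF R] \<xi>[OF C] \<xi>[OF D] by blast
    then show ?thesis
      using leads_to_iff_set_reaches[OF X, of "\<xi> C" "\<xi> D"] leads_to_iff_set_reaches[OF Y, of "\<eta> C" "\<eta> D"]
        \<xi>[OF C] \<xi>[OF D] by (simp add: h_def)
  qed
  have h_inj: "C = D" if C: "proper_communication_set ?E C" and D: "proper_communication_set ?E D"
    and eq: "h C = h D" for C D
    using set_reaches_antisym[OF wf_left_krieger_cover C D] h_iff[OF C D] h_iff[OF D C]
      set_reaches_refl[OF hP[OF D]] eq by simp
  have h_surj: "\<exists>C. proper_communication_set ?E C \<and> h C = D" if D: "proper_communication_set ?F D" for D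
  proof -
    obtain y where y: "y \<in> Y" "limit_set Y y = D" using limit_set_surj[OF Y D] by blast
    obtain x where x: "x \<in> X" "R x y" using leads_to_correspondenceD(2)[OF R y(1)] by blast
    define C where "C = limit_set X x"
    have C: "proper_communication_set ?E C"
      unfolding C_def by (rule proper_communication_set_limit_set[OF X x(1)])
    have \<xi>C: "\<xi> C \<in> X" "limit_set X (\<xi> C) = C" "\<eta> C \<in> Y" "R (\<xi> C) (\<eta> C)" using \<xi>[OF C] by auto
    \<comment> \<open>\<open>x\<close> and the chosen \<open>\<xi> C\<close> may differ but have the
      same limit set, so they lead to each other, and so do their partners in
      \<open>Y\<close>.\<close>
    have "leads_to X (\<xi> C) x" "leads_to X x (\<xi> C)"
      using leads_to_iff_set_reaches[OF X, of "\<xi> C" x] leads_to_iff_set_reaches[OF X, of x "\<xi> C"]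
        \<xi>C x(1) set_reaches_refl[OF C] by (simp_all add: C_def)
    then have "leads_to Y (\<eta> C) y" "leads_to Y y (\<eta> C)"
      using leads_to_correspondenceD(3)[OF R] x y \<xi>C by blast+
    then have "set_reaches ?F (h C) D" "set_reaches ?F D (h C)"
      using leads_to_iff_set_reaches[OF Y, of "\<eta> C" y] leads_to_iff_set_reaches[OF Y, of y "\<eta> C"]
        y \<xi>C by (simp_all add: h_def)
    then show ?thesis using set_reaches_antisym[OF wf_left_krieger_cover hP[OF C] D] C by blast
  qed
  have h_verts: "h ` {C. proper_communication_set ?E C} = {D. proper_communication_set ?F D}"
    using hP h_surj by blast
  have arcs_G: "arcs ?G = {(C, D). proper_communication_set ?E C \<and> proper_communication_set ?E D \<and>
      C \<noteq> D \<and> set_reaches ?E C D}"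
    by (simp add: proper_communication_graph_def set_reaches_def)
  have arcs_H: "arcs ?H = {(C, D). proper_communication_set ?F C \<and> proper_communication_set ?F D \<and>
      C \<noteq> D \<and> set_reaches ?F C D}"
    by (simp add: proper_communication_graph_def set_reaches_def)
  have h_arcs: "map_prod h h ` arcs ?G = arcs ?H"
  proof
    show "map_prod h h ` arcs ?G \<subseteq> arcs ?H"
      unfolding arcs_G arcs_H using hP h_iff by (auto dest: h_inj)
    show "arcs ?H \<subseteq> map_prod h h ` arcs ?G"
    proof
      fix e assume "e \<in> arcs ?H"
      then obtain C' D' where e: "e = (C', D')" and C': "proper_communication_set ?F C'"
        and D': "proper_communication_set ?F D'" and CD': "C' \<noteq> D'" "set_reaches ?F C' D'"
        unfolding arcs_H by blast
      obtain C D where C: "proper_communication_set ?E C" "h C = C'"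
        and D: "proper_communication_set ?E D" "h D = D'"
        using h_surj[OF C'] h_surj[OF D'] by blast
      have "(C, D) \<in> arcs ?G" unfolding arcs_G using C D CD' h_iff[OF C(1) D(1)] by auto
      then show "e \<in> map_prod h h ` arcs ?G" using C(2) D(2) e by force
    qed
  qed
  define hom where "hom = \<lparr>iso_verts = h, iso_arcs = map_prod h h, iso_head = snd, iso_tail = fst\<rparr>"
  have wf: "wf_digraph ?G" by standard (auto simp: proper_communication_graph_def)
  have "pre_digraph.digraph_isomorphism ?G hom"
    unfolding pre_digraph.digraph_isomorphism_def
  proof (intro conjI ballI wf)
    show "inj_on (iso_verts hom) (verts ?G)"
      using h_inj by (auto simp: hom_def inj_on_def proper_communication_graph_def)
    show "inj_on (iso_arcs hom) (arcs ?G)"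
      using h_inj unfolding arcs_G by (auto simp: hom_def inj_on_def)
  qed (simp_all add: hom_def proper_communication_graph_def)
  moreover have "?H = app_iso hom ?G"
    using h_verts h_arcs by (simp add: app_iso_def hom_def proper_communication_graph_def)
  ultimately show ?thesis unfolding digraph_iso_def by blast
qed

section \<open>Sofic shifts\<close>

lemma occurs_in_shift_map: "occurs_in w (shift_map x) \<longleftrightarrow> occurs_in w x"
proof
  assume "occurs_in w (shift_map x)"
  then obtain i where i: "\<forall>k<length w. w ! k = x (i + int k + 1)"
    by (auto simp: occurs_in_iff shift_map_def)
  then show "occurs_in w x"
    unfolding occurs_in_iff by (intro exI[of _ "i + 1"]) (simp add: algebra_simps)
next
  assume "occurs_in w x"
  then obtain i where i: "\<forall>k<length w. w ! k = x (i + int k)" by (auto simp: occurs_in_iff)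
  then show "occurs_in w (shift_map x)"
    unfolding occurs_in_iff shift_map_def by (intro exI[of _ "i - 1"]) simp
qed

lemma finite_type_imp_shift_space:
  assumes "finite_type A X"
  shows "shift_space A X"
proof -
  obtain F where A: "finite A"
    and X: "X = {x. range x \<subseteq> A \<and> (\<forall>w\<in>F. \<not> occurs_in w x)}"
    using assms by (auto simp: finite_type_def)
  have "openin (full_shift_topology A) ({x. range x \<subseteq> A} - X)"
    unfolding openin_full_shift_iff
  proof (intro conjI ballI)
    fix x assume "x \<in> {x. range x \<subseteq> A} - X"
    then obtain w i where w: "w \<in> F" "\<And>k. k < length w \<Longrightarrow> w ! k = x (i + int k)"
      by (auto simp: X occurs_in_iff)
    have "z \<in> {x. range x \<subseteq> A} - X"
      if z: "range z \<subseteq> A" "\<forall>l. \<bar>l\<bar> \<le> \<bar>i\<bar> + int (length w) \<longrightarrow> z l = x l" for z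
    proof -
      have "w ! k = z (i + int k)" if "k < length w" for k
        using w(2)[OF that] z(2) that by auto
      then have "occurs_in w z" unfolding occurs_in_iff by blast
      then show ?thesis using w(1) z(1) by (auto simp: X)
    qed
    then show "\<exists>n. \<forall>z. range z \<subseteq> A \<and> (\<forall>i. \<bar>i\<bar> \<le> n \<longrightarrow> z i = x i) \<longrightarrow> z \<in> {x. range x \<subseteq> A} - X"
      by blast
  qed auto
  then have "closedin (full_shift_topology A) X"
    unfolding closedin_def topspace_full_shift by (auto simp: X)
  moreover have "shift_map ` X = X"
  proof
    show "shift_map ` X \<subseteq> X"
      by (auto simp: X occurs_in_shift_map) (auto simp: shift_map_def)
    show "X \<subseteq> shift_map ` X"
    proof
      fix x assume x: "x \<in> X"
      define z where "z = (\<lambda>i. x (i - 1))"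
      have xz: "x = shift_map z" by (simp add: z_def shift_map_def)
      have "range z \<subseteq> A" using x by (auto simp: X z_def)
      moreover have "\<not> occurs_in w z" if "w \<in> F" for w
        using x that occurs_in_shift_map[of w z] by (simp add: X xz)
      ultimately have "z \<in> X" by (simp add: X)
      then show "x \<in> shift_map ` X" using xz by blast
    qed
  qed
  ultimately show ?thesis using A by (simp add: shift_space_def)
qed

text \<open>Forbidden words have length at most \<open>K\<close>. An occurrence extending beyond the
  cut at \<open>n\<close> therefore starts no earlier than \<open>-n\<close>, where the splice
  coincides with \<open>z\<close>; any other occurrence lies inside \<open>x\<close>.\<close>

lemma finite_type_splice:
  assumes "finite_type A X"
  shows "\<exists>K\<ge>0. \<forall>n\<ge>K. \<forall>x\<in>X. \<forall>z\<in>X. (\<forall>i. - n \<le> i \<and> i < n \<longrightarrow> x i = z i) \<longrightarrow> splice_at n x z \<in> X"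
proof -
  obtain F where F: "finite F" and X: "X = {x. range x \<subseteq> A \<and> (\<forall>w\<in>F. \<not> occurs_in w x)}"
    using assms by (auto simp: finite_type_def)
  define K where "K = int (Max (insert 0 (length ` F)))"
  have K: "int (length w) \<le> K" if "w \<in> F" for w
    unfolding K_def using F that by simp
  have "splice_at n x z \<in> X"
    if n: "n \<ge> K" and x: "x \<in> X" and z: "z \<in> X"
      and agree: "\<forall>i. - n \<le> i \<and> i < n \<longrightarrow> x i = z i" for n x z
  proof -
    have left: "splice_at n x z i = x i" if "i < n" for i using that by (simp add: splice_at_def)
    have right: "splice_at n x z i = z i" if "i \<ge> - n" for i using that agree by (simp add: splice_at_def)
    have "\<not> occurs_in w (splice_at n x z)" if w: "w \<in> F" for w
    proof
      assume "occurs_in w (splice_at n x z)"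
      then obtain i where i: "\<And>k. k < length w \<Longrightarrow> w ! k = splice_at n x z (i + int k)"
        unfolding occurs_in_iff by blast
      show False
      proof (cases "i + int (length w) \<le> n")
        case True
        then have "\<forall>k<length w. w ! k = x (i + int k)" using i left by simp
        then show False using x w unfolding X occurs_in_iff by blast
      next
        case False
        then have "- n \<le> i" using K[OF w] n by simp
        then have "\<forall>k<length w. w ! k = z (i + int k)" using i right by simp
        then show False using z w unfolding X occurs_in_iff by blast
      qed
    qed
    moreover have "range (splice_at n x z) \<subseteq> A" using x z by (auto simp: X splice_at_def)
    ultimately show ?thesis by (simp add: X)
  qed
  then show ?thesis by (intro exI[of _ K]) (simp add: K_def)
qed

text \<open>The vertex of a right-ray depends only on the set of central words of its preimages in the
  covering shift of finite type.\<close>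

lemma sofic_finite_verts:
  assumes "sofic A X"
  shows "finite (verts (left_krieger_cover X))"
proof -
  have X: "shift_space A X" using assms by (simp add: sofic_def)
  have sX: "shift_map ` X = X" using X by (simp add: shift_space_def)
  obtain B :: "nat set" and Y f where ft: "finite_type B Y" and fm: "factor_map B Y A X f"
    using assms by (auto simp: sofic_def)
  have Y: "shift_space B Y" by (rule finite_type_imp_shift_space[OF ft])
  have finB: "finite B" using ft by (simp add: finite_type_def)
  have YB: "range y \<subseteq> B" if "y \<in> Y" for y using ft that by (auto simp: finite_type_def)
  have fY: "f ` Y = X" and cont: "continuous_map (shift_topology B Y) (shift_topology A X) f"
    and eq: "\<And>y. y \<in> Y \<Longrightarrow> f (shift_map y) = shift_map (f y)"
    using fm by (auto simp: factor_map_def)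
  obtain m where m: "block_code m Y f" using curtis_hedlund_lyndon[OF Y X cont eq] by blast
  obtain K where K: "\<And>n y z. n \<ge> K \<Longrightarrow> y \<in> Y \<Longrightarrow> z \<in> Y \<Longrightarrow>
      (\<forall>i. - n \<le> i \<and> i < n \<longrightarrow> y i = z i) \<Longrightarrow> splice_at n y z \<in> Y"
    using finite_type_splice[OF ft] by blast
  \<comment> \<open>\<open>n \<ge> K\<close> permits splicing at \<open>n\<close>.
    \<open>n \<ge> m\<close> keeps the windows of negative coordinates left of \<open>n\<close>, and
    those of the other coordinates at or right of \<open>-n\<close>.\<close>
  define n where "n = max K m"
  have n: "n \<ge> K" "n \<ge> m" by (simp_all add: n_def)
  define S where "S = (\<lambda>x. {map y [-n..n - 1] |y. y \<in> Y \<and> (\<forall>i\<ge>0. f y i = x i)})"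
  have aux: "splice_at 0 w z \<in> X" if S: "S x = S z" and w: "splice_at 0 w x \<in> X" for x z w
  proof -
    obtain y where y: "y \<in> Y" "f y = splice_at 0 w x" using w fY by (metis imageE)
    then have "map y [-n..n - 1] \<in> S x" by (auto simp: S_def splice_at_def)
    then have "map y [-n..n - 1] \<in> S z" using S by simp
    then obtain t where t: "t \<in> Y" "\<forall>i\<ge>0. f t i = z i" "map y [-n..n - 1] = map t [-n..n - 1]"
      unfolding S_def by (elim CollectE exE conjE)
    have agree: "y i = t i" if "- n \<le> i" "i < n" for i
      using t(3) that by simp
    \<comment> \<open>The splice keeps the image of \<open>y\<close> left of 0 and takes that of
      \<open>t\<close> from 0 on, because \<open>y\<close> and \<open>t\<close> share their central
      word.\<close>
    have u: "splice_at n y t \<in> Y" using K[OF n(1) y(1) t(1)] agree by blast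
    have "f (splice_at n y t) i = splice_at 0 w z i" for i
    proof (cases "i < 0")
      case True
      have "f (splice_at n y t) i = f y i"
        by (rule block_codeD[OF m u y(1)]) (use True n in \<open>auto simp: splice_at_def\<close>)
      then show ?thesis using y(2) True by (simp add: splice_at_def)
    next
      case False
      have "f (splice_at n y t) i = f t i"
        by (rule block_codeD[OF m u t(1)]) (use False n agree in \<open>auto simp: splice_at_def\<close>)
      then show ?thesis using t(2) False by (simp add: splice_at_def)
    qed
    then have "f (splice_at n y t) = splice_at 0 w z" by blast
    then show ?thesis using u fY by (metis imageI)
  qed
  have vertex: "vertex_at X 0 x = vertex_at X 0 z" if "S x = S z" for x z
    unfolding vertex_at_eq_iff[OF sX] same_past_def using aux[OF that] aux[OF that[symmetric]] by blast
  have "S x \<subseteq> {w. set w \<subseteq> B \<and> length w = nat (2 * n)}" for x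
    using YB by (fastforce simp: S_def)
  then have "S ` X \<subseteq> Pow {w. set w \<subseteq> B \<and> length w = nat (2 * n)}" by blast
  then have "finite (S ` X)"
    by (rule finite_subset) (simp add: finite_lists_length_eq[OF finB])
  moreover have "vertex_at X 0 ` X \<subseteq> (\<lambda>c. vertex_at X 0 (SOME x. S x = c)) ` (S ` X)"
  proof
    fix v assume "v \<in> vertex_at X 0 ` X"
    then obtain x where x: "x \<in> X" "v = vertex_at X 0 x" by blast
    have "S (SOME z. S z = S x) = S x" by (rule someI[of _ x]) simp
    then have "v = vertex_at X 0 (SOME z. S z = S x)" using x(2) vertex by metis
    then show "v \<in> (\<lambda>c. vertex_at X 0 (SOME x. S x = c)) ` (S ` X)" using x(1) by blast
  qed
  ultimately show ?thesis unfolding verts_left_krieger_cover using finite_surj by blast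
qed

lemma flow_equivalent_imp_leads_to_equiv:
  assumes "flow_equivalent A X B Y"
  shows "leads_to_equiv X Y"
proof -
  define r :: "nat set \<times> (int \<Rightarrow> nat) set \<Rightarrow> nat set \<times> (int \<Rightarrow> nat) set \<Rightarrow> bool"
    where "r = (\<lambda>(C, Z) (C', Z'). conjugate C Z C' Z' \<or> symbol_expansion C Z C' Z')"
  obtain A' X' B' Y' where AX: "conjugate A X A' X'" and r: "equivclp r (A', X') (B', Y')"
    and BY: "conjugate B' Y' B Y"
    using assms unfolding flow_equivalent_def r_def by blast
  have r_step: "leads_to_equiv (snd p) (snd q)" if "r p q" for p q
    using that by (auto simp: r_def split: prod.splits
        intro: conjugate_imp_leads_to_equiv symbol_expansion_imp_leads_to_equiv)
  have "leads_to_equiv (snd p) (snd q)" if "equivclp r p q" for p q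
    using that
  proof (induction rule: equivclp_induct)
    case base
    show ?case by (rule leads_to_equiv_refl)
  next
    case (step q q')
    then show ?case
      using r_step by (blast intro: leads_to_equiv_trans leads_to_equiv_sym)
  qed
  then have "leads_to_equiv X' Y'" using r by fastforce
  then show ?thesis
    using conjugate_imp_leads_to_equiv[OF AX] conjugate_imp_leads_to_equiv[OF BY]
    by (blast intro: leads_to_equiv_trans)
qed

theorem theorem3p10:
  fixes X :: "(int \<Rightarrow> 'a) set" and Y :: "(int \<Rightarrow> 'b) set"
    and A :: "'a set" and B :: "'b set"
  assumes "sofic A X" and "sofic B Y"
    and "flow_equivalent A X B Y"
  shows "digraph_iso (proper_communication_graph (left_krieger_cover X))
                     (proper_communication_graph (left_krieger_cover Y))"
proof (rule digraph_iso_proper_communication_graph)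
  show "shift_space A X" "shift_space B Y" using assms(1,2) by (simp_all add: sofic_def)
qed (fact sofic_finite_verts[OF assms(1)] sofic_finite_verts[OF assms(2)]
      flow_equivalent_imp_leads_to_equiv[OF assms(3)])+

end
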